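(* Let $\mathbf{f}\in\mathbb{R}^n$ have prior $\mathbf{f}\sim\mathcal{N}(\mathbf{m},\mathbf{K})$, where $\mathbf{K}\in\mathbb{R}^{n\times n}$ is symmetric positive semidefinite ($\mathbf{K}\succeq 0$), and let the observations be $\mathbf{y}=\mathbf{H}\mathbf{f}+\boldsymbol{\varepsilon}$ with $\mathbf{H}\in\mathbb{R}^{p\times n}$ and $\boldsymbol{\varepsilon}\sim\mathcal{N}(\mathbf{0},\mathbf{R})$ independent of $\mathbf{f}$, where $\mathbf{R}\in\mathbb{R}^{p\times p}$ is symmetric positive definite ($\mathbf{R}\succ 0$). Define the displacement variable $$\mathbf{x}:=\mathbf{f}-\mathbf{m}\in\mathbb{R}^n,\qquad \mathbf{d}:=\mathbf{y}-\mathbf{H}\mathbf{m}\in\mathbb{R}^p.$$ (1) The negative log-posterior (up to an additive constant) is the convex quadratic $$\mathcal{J}(\mathbf{x})=\tfrac12\,\mathbf{x}^\top\mathbf{Q}\,\mathbf{x}+\mathbf{q}^\top\mathbf{x}+c,\qquad \mathbf{x}\in\mathrm{Range}(\mathbf{K}),$$ with $$\mathbf{Q}:=\mathbf{K}^\dagger+\mathbf{H}^\top\mathbf{R}^{-1}\mathbf{H}\in\mathbb{R}^{n\times n},\qquad \mathbf{q}:=-\mathbf{H}^\top\mathbf{R}^{-1}\mathbf{d}\in\mathbb{R}^n,\qquad c:=\tfrac12\,\mathbf{d}^\top\mathbf{R}^{-1}\mathbf{d}\in\mathbb{R}.$$ If $\mathbf{K}\succ 0$, then $\mathbf{x}$ ranges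 over $\mathbb{R}^n$ and $\mathbf{Q}\succ 0$; if $\mathbf{K}\succeq 0$ is singular, the objective is finite only in $\mathrm{Range}(\mathbf{K})$. (2) The unique minimizer $\mathbf{x}_\star$ of this quadratic form satisfies the normal equations $$\mathbf{Q}\mathbf{x}_\star=-\mathbf{q},$$ and the posterior mean is $\mathbf{m}_{\mathrm{post}}=\mathbf{m}+\mathbf{x}_\star$. (3) Moreover, $\mathbf{m}_{\mathrm{post}}$ equals the conditional mean $\mathbb{E}[\mathbf{f}\mid\mathbf{y}]$.
   Context: $\mathbf{K}^\dagger$ denotes the Moore–Penrose pseudoinverse of $\mathbf{K}$, and $\mathrm{Range}(\mathbf{K})$ its column space. The negative log-posterior is minus the logarithm of the conditional (posterior) density of $\mathbf{f}$ given $\mathbf{y}$, written as a function of $\mathbf{x}=\mathbf{f}-\mathbf{m}$; it is the sum, up to a constant, of the data misfit $\tfrac12(\mathbf{d}-\mathbf{H}\mathbf{x})^\top\mathbf{R}^{-1}(\mathbf{d}-\mathbf{H}\mathbf{x})$ and the prior term $\tfrac12\mathbf{x}^\top\mathbf{K}^\dagger\mathbf{x}$ on $\mathrm{Range}(\mathbf{K})$. The conditional mean $\mathbb{E}[\mathbf{f}\mid\mathbf{y}]$ is the mean of the conditional Gaussian law of $\mathbf{f}$ given $\mathbf{y}$ under the jointly Gaussian law of $(\mathbf{f},\mathbf{y})$.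
   Formalization: For singular K, the minimizer over Range(K) need not satisfy Qx⋆ = −q (K=0, H=R=d=1), so the full normal equations are claimed only if K ≻ 0 or Range(Hᵀ) ⊆ Range(K); for general K ⪰ 0 they are claimed tested against vectors v in Range(K). *)

theory Defs
  imports "HOL-Probability.Probability"
begin

definition pos_semidef :: "real^'n^'n \<Rightarrow> bool" where
  "pos_semidef A \<longleftrightarrow> transpose A = A \<and> (\<forall>x. 0 \<le> x \<bullet> (A *v x))"

definition pos_def :: "real^'n^'n \<Rightarrow> bool" where
  "pos_def A \<longleftrightarrow> transpose A = A \<and> (\<forall>x. x \<noteq> 0 \<longrightarrow> 0 < x \<bullet> (A *v x))"

text \<open>Moore--Penrose pseudoinverse, by the four Penrose conditions.\<close>

definition pinv :: "real^'n^'m \<Rightarrow> real^'m^'n" where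
  "pinv A = (THE X. A ** X ** A = A \<and> X ** A ** X = X \<and>
     transpose (A ** X) = A ** X \<and> transpose (X ** A) = X ** A)"

definition std_gaussian :: "(real^'n) measure" where
  "std_gaussian = density lborel (\<lambda>z. ennreal (\<Prod>i\<in>UNIV. std_normal_density (z $ i)))"

text \<open>
  \<open>N\<close> is the law N(m, K) when it is the law of \<open>m + A Z\<close> with \<open>Z\<close> standard Gaussian and
  \<open>A A\<^sup>T = K\<close>.  Unlike a density with respect to \<open>lborel\<close>, this also makes sense for singular \<open>K\<close>.
\<close>

definition gaussian_law :: "(real^'n) measure \<Rightarrow> real^'n \<Rightarrow> real^'n^'n \<Rightarrow> bool" where
  "gaussian_law N m K \<longleftrightarrow>
     (\<exists>A :: real^'n^'n. A ** transpose A = K \<and> N = distr std_gaussian borel (\<lambda>z. m + A *v z))"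

text \<open>
  Lebesgue measure on the affine subspace \<open>m + S\<close>, seen as a Borel measure on the whole space: the
  image of the product Lebesgue measure on the coordinates in an orthonormal basis of the linear
  subspace \<open>S\<close>.  It does not depend on the basis; for \<open>S = UNIV\<close> it is \<open>lborel\<close>, and for
  \<open>S = {0}\<close> the point mass at \<open>m\<close>.
\<close>

definition lborel_affine :: "'a::euclidean_space \<Rightarrow> 'a set \<Rightarrow> 'a measure" where
  "lborel_affine m S =
     (let B = (SOME B. pairwise orthogonal B \<and> (\<forall>b\<in>B. norm b = 1) \<and> span B = S)
      in distr (\<Pi>\<^sub>M b\<in>B. (lborel :: real measure)) borel (\<lambda>c. m + (\<Sum>b\<in>B. c b *\<^sub>R b)))"

text \<open>
  \<open>\<kappa>\<close> is a regular conditional distribution of \<open>X\<close> given \<open>Y\<close>; \<open>\<kappa> \<eta>\<close> is the law of \<open>X\<close> given \<open>Y = \<eta>\<close>.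
\<close>

definition regular_cond_law ::
  "'a measure \<Rightarrow> ('a \<Rightarrow> 'b::topological_space) \<Rightarrow> ('a \<Rightarrow> 'c::topological_space) \<Rightarrow>
     ('c \<Rightarrow> 'b measure) \<Rightarrow> bool" where
  "regular_cond_law M X Y \<kappa> \<longleftrightarrow>
     \<kappa> \<in> borel \<rightarrow>\<^sub>M prob_algebra borel \<and>
     (\<forall>A\<in>sets borel. \<forall>B\<in>sets borel.
        emeasure M {\<omega> \<in> space M. X \<omega> \<in> A \<and> Y \<omega> \<in> B} =
        (\<integral>\<^sup>+\<eta>. emeasure (\<kappa> \<eta>) A * indicator B \<eta> \<partial>distr M borel Y))"

text \<open>\<open>- ln u\<close> with \<open>- ln 0 = \<infinity>\<close>, whereas \<open>ln 0 = 0\<close> for the total function \<open>ln\<close> on \<open>real\<close>.\<close>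

definition neg_log :: "real \<Rightarrow> ereal" where
  "neg_log u = (if 0 < u then ereal (- ln u) else \<infinity>)"

end

theory Submission
  imports Defs
begin

text \<open>
  Let \<open>P\<close> be the orthogonal projection onto \<open>S = Range(K)\<close>.  The matrix \<open>L = K + (1 - P)\<close> is positive definite with
  inverse \<open>K\<^sup>\<dagger> + (1 - P)\<close>, and if \<open>K = A A\<^sup>T\<close> then \<open>A = P V\<close> for some \<open>V\<close> with \<open>V V\<^sup>T = L\<close>.  So a degenerate
  Gaussian vector \<open>A Z\<close> is the projection of a nondegenerate one whose density is a function of \<open>P u\<close> times a
  function of \<open>u - P u\<close>; integrating out the second factor gives its density on \<open>m + S\<close>.

  The prior density on \<open>m + S\<close> is thus proportional to \<open>exp (- x\<^sup>T K\<^sup>\<dagger> x / 2)\<close>, and Bayes' rule gives a posterior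
  proportional to \<open>exp (- J \<eta> x)\<close>.  The matrix \<open>W = P Q P + (1 - P)\<close> is positive definite, and completing the square
  around \<open>W\<^sup>-\<^sup>1 P (- q)\<close>, which lies in \<open>S\<close>, identifies this point as the minimiser.  The same lemma on degenerate
  Gaussians, applied to \<open>W\<close>, identifies the posterior as a Gaussian law centred at the minimiser.
\<close>

section \<open>Lebesgue measure and subspaces\<close>

text \<open>Singular \<open>K\<close> is the obstacle throughout. The prior then has no density with
  respect to \<open>lborel\<close>, so Bayes' rule is set up relative to the prior itself times
  Lebesgue measure in the observation, and Lebesgue measure on m + S enters only afterwards.
  \<open>gaussian_law\<close> allows every factor \<open>A\<close> with A A^T = K, so the completion
  of \<open>A\<close> to an invertible matrix has to work for an arbitrary one. The term H^T R^-1 H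
  of \<open>Q\<close> can mix S with its complement, and \<open>Q\<close> may be degenerate off S;
  this is why \<open>Q\<close> is compressed to P Q P before anything is inverted. The same mixing
  limits the normal equations. A minimiser over S need only satisfy P Q x = - P q: for K = 0 it is x
  = 0, whereas q need not vanish. The full equation is therefore asserted when \<open>K\<close> is
  positive definite or the range of H^T lies in S. No determinant is evaluated: normalising
  constants are only shown to be positive and finite, and comparing total masses does the
  rest.\<close>

lemma lborel_distr_uminus_euclidean: "distr lborel borel uminus = (lborel :: 'a::euclidean_space measure)"
  using lborel_affine[of "-1" "0::'a"] by (simp add: density_1)

lemma nn_integral_lborel_shift:
  fixes g :: "'a::euclidean_space \<Rightarrow> ennreal"
  assumes [measurable]: "g \<in> borel_measurable borel"
  shows "(\<integral>\<^sup>+y. g (x + y) \<partial>lborel) = (\<integral>\<^sup>+y. g y \<partial>lborel)"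
  by (subst (2) lborel_distr_plus[symmetric, of x]) (simp add: nn_integral_distr)

lemma nn_integral_lborel_reflect:
  fixes g :: "'a::euclidean_space \<Rightarrow> ennreal"
  assumes [measurable]: "g \<in> borel_measurable borel"
  shows "(\<integral>\<^sup>+y. g (x - y) \<partial>lborel) = (\<integral>\<^sup>+y. g y \<partial>lborel)"
proof -
  have "(\<integral>\<^sup>+y. g (x - y) \<partial>lborel) = (\<integral>\<^sup>+y. g (x - y) \<partial>distr lborel borel uminus)"
    by (simp add: lborel_distr_uminus_euclidean)
  also have "\<dots> = (\<integral>\<^sup>+y. g (x + y) \<partial>lborel)"
    by (subst nn_integral_distr) simp_all
  finally show ?thesis by (simp add: nn_integral_lborel_shift)
qed

text \<open>
  Uniqueness of Haar measure in integral form: shift \<open>h\<close> by \<open>x\<close> under \<open>lborel\<close>, swap the integrals, shift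
  \<open>x\<close> by \<open>- y\<close> under \<open>\<mu>\<close>, swap back, and reflect.  This yields the linear change of variables for every finite
  index type; the determinant formula of the library is only available for well-ordered ones.
\<close>

lemma translation_invariant_nn_integral:
  fixes \<mu> :: "'a::euclidean_space measure"
  assumes [measurable_cong]: "sets \<mu> = sets borel" and "sigma_finite_measure \<mu>"
    and shift: "\<And>x. distr \<mu> borel ((+) x) = \<mu>"
    and g[measurable]: "g \<in> borel_measurable borel" and h[measurable]: "h \<in> borel_measurable borel"
  shows "(\<integral>\<^sup>+x. g x \<partial>\<mu>) * (\<integral>\<^sup>+x. h x \<partial>lborel) = (\<integral>\<^sup>+x. h x \<partial>\<mu>) * (\<integral>\<^sup>+x. g x \<partial>lborel)"
proof -
  interpret \<mu>: sigma_finite_measure \<mu> by fact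
  interpret pair_sigma_finite \<mu> lborel by standard
  have shift': "(\<integral>\<^sup>+x. k (y + x) \<partial>\<mu>) = (\<integral>\<^sup>+x. k x \<partial>\<mu>)"
    if [measurable]: "k \<in> borel_measurable borel" for k :: "'a \<Rightarrow> ennreal" and y
    by (subst (2) shift[symmetric, of y]) (simp add: nn_integral_distr)
  have "(\<integral>\<^sup>+x. g x \<partial>\<mu>) * (\<integral>\<^sup>+x. h x \<partial>lborel) = (\<integral>\<^sup>+x. \<integral>\<^sup>+y. g x * h (x + y) \<partial>lborel \<partial>\<mu>)"
    by (simp add: nn_integral_cmult nn_integral_multc nn_integral_lborel_shift)
  also have "\<dots> = (\<integral>\<^sup>+y. \<integral>\<^sup>+x. g x * h (x + y) \<partial>\<mu> \<partial>lborel)"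
    by (rule Fubini'[symmetric]) measurable
  also have "\<dots> = (\<integral>\<^sup>+y. \<integral>\<^sup>+x. g (x - y) * h x \<partial>\<mu> \<partial>lborel)"
  proof (rule nn_integral_cong)
    fix y
    show "(\<integral>\<^sup>+x. g x * h (x + y) \<partial>\<mu>) = (\<integral>\<^sup>+x. g (x - y) * h x \<partial>\<mu>)"
      using shift'[of "\<lambda>x. g (x - y) * h x" y] by (simp add: add.commute)
  qed
  also have "\<dots> = (\<integral>\<^sup>+x. \<integral>\<^sup>+y. g (x - y) * h x \<partial>lborel \<partial>\<mu>)"
    by (rule Fubini') measurable
  also have "\<dots> = (\<integral>\<^sup>+x. h x \<partial>\<mu>) * (\<integral>\<^sup>+x. g x \<partial>lborel)"
    by (simp add: nn_integral_cmult nn_integral_multc nn_integral_lborel_reflect mult.commute)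
  finally show ?thesis .
qed

text \<open>The image of Lebesgue measure under a linear bijection is translation invariant, since f
  y + x = f (y + g x) for the inverse \<open>g\<close>; uniqueness of Haar measure then makes it a
  multiple of Lebesgue measure.\<close>

lemma distr_lborel_linear:
  fixes f :: "'a::euclidean_space \<Rightarrow> 'a"
  assumes "linear f" "inj f"
  obtains c where "0 < c" "c < \<infinity>" "distr lborel borel f = density lborel (\<lambda>_. c)"
proof -
  let ?\<mu> = "distr lborel borel f"
  have [measurable]: "f \<in> borel_measurable borel"
    by (intro borel_measurable_continuous_onI linear_continuous_on linear_conv_bounded_linear[THEN iffD1] assms)
  obtain g where "linear g" and gf: "g \<circ> f = id"
    using linear_injective_left_inverse[OF assms] by blast
  then have fg: "f \<circ> g = id" using linear_inverse_left[OF assms(1)] by blast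
  have "f (g x) = x" "g (f x) = x" for x
    using fg gf by (simp_all add: fun_eq_iff)
  note gf_id = this
  have vim: "f -` A = g ` A" for A
  proof
    show "f -` A \<subseteq> g ` A" by (metis gf_id(2) image_eqI subsetI vimage_eq)
    show "g ` A \<subseteq> f -` A" using gf_id(1) by auto
  qed
  have [measurable]: "g \<in> borel_measurable borel"
    by (intro borel_measurable_continuous_onI linear_continuous_on linear_conv_bounded_linear[THEN iffD1]) fact
  have distr_g: "distr (distr lborel borel f) borel g = lborel"
    using gf by (simp add: distr_distr o_def fun_eq_iff id_def distr_id2)
  \<comment> \<open>Sigma-finiteness is inherited backwards: pushing the image measure forward by
    \<open>g\<close> gives \<open>lborel\<close>, which is sigma-finite.\<close>
  have sf: "sigma_finite_measure ?\<mu>"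
  proof (rule sigma_finite_measure_distr)
    show "sigma_finite_measure (distr ?\<mu> borel g)" by (simp only: distr_g sigma_finite_lborel)
  qed simp
  have shift: "distr ?\<mu> borel ((+) x) = ?\<mu>" for x
  proof -
    have "distr ?\<mu> borel ((+) x) = distr (distr lborel borel ((+) (g x))) borel f"
      using fg by (simp add: distr_distr o_def linear_add[OF assms(1)] fun_eq_iff)
    then show ?thesis by (simp add: lborel_distr_plus)
  qed
  \<comment> \<open>Testing against the unit cube, of volume 1, identifies the factor. It is finite
    because \<open>g\<close> maps the cube to a bounded set, and nonzero because otherwise the image
    measure would vanish.\<close>
  let ?c = "emeasure lborel (f -` cbox 0 One)"
  have eq: "?\<mu> = density lborel (\<lambda>_. ?c)"
  proof (rule measure_eqI)
    fix A assume "A \<in> sets ?\<mu>"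
    then have [measurable]: "A \<in> sets borel" by simp
    show "emeasure ?\<mu> A = emeasure (density lborel (\<lambda>_. ?c)) A"
      using translation_invariant_nn_integral[OF _ sf shift, of "indicator A" "indicator (cbox 0 One)"]
      by (simp add: emeasure_distr emeasure_density_const)
  qed simp
  have "bounded (g ` cbox 0 One)" using \<open>linear g\<close> by (simp add: bounded_linear_image linear_conv_bounded_linear)
  then have "?c < \<infinity>" unfolding vim by (rule emeasure_bounded_finite)
  moreover have "?c \<noteq> 0"
  proof
    assume "?c = 0"
    then have "emeasure ?\<mu> UNIV = 0" using eq by (simp add: emeasure_density)
    then show False by (simp add: emeasure_distr)
  qed
  ultimately show thesis using that[of ?c] eq by (simp add: zero_less_iff_neq_zero)
qed

text \<open>An orthogonal map preserves the unit ball, whose volume is positive and finite, so the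
  scaling factor can only be 1.\<close>

lemma distr_lborel_orthogonal:
  fixes f :: "'a::euclidean_space \<Rightarrow> 'a"
  assumes "orthogonal_transformation f"
  shows "distr lborel borel f = lborel"
proof -
  have lin: "linear f" and inj: "inj f"
    using assms orthogonal_transformation_linear orthogonal_transformation_inj by auto
  obtain c where c: "0 < c" "c < \<infinity>" "distr lborel borel f = density lborel (\<lambda>_. c)"
    using distr_lborel_linear[OF lin inj] by metis
  have [measurable]: "f \<in> borel_measurable borel"
    by (intro borel_measurable_continuous_onI linear_continuous_on linear_conv_bounded_linear[THEN iffD1] lin)
  have "f -` ball 0 1 = ball 0 1"
    using assms by (auto simp: orthogonal_transformation)
  then have "emeasure lborel (ball (0::'a) 1) = c * emeasure lborel (ball (0::'a) 1)"
    using arg_cong[OF c(3), of "\<lambda>M. emeasure M (ball 0 1)"]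
    by (simp add: emeasure_distr emeasure_density_const)
  moreover have "emeasure lborel (ball (0::'a) 1) < \<infinity>" using emeasure_lborel_ball_finite by auto
  moreover have "emeasure lborel (ball (0::'a) 1) \<noteq> 0"
    using content_ball_pos[of 1 "0::'a"] by (auto simp: measure_def)
  ultimately have "c = 1"
    using ennreal_mult_cancel_left[of "emeasure lborel (ball (0::'a) 1)" 1 c] by (auto simp: mult.commute)
  then show ?thesis using c by (simp add: density_1)
qed

section \<open>Lebesgue measure in orthonormal coordinates\<close>

definition orthonormal_basis_of :: "'a::euclidean_space set \<Rightarrow> 'a set \<Rightarrow> bool" where
  "orthonormal_basis_of S B \<longleftrightarrow> pairwise orthogonal B \<and> (\<forall>b\<in>B. norm b = 1) \<and> span B = S"

lemma orthonormal_basis_of_finite: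
  assumes "orthonormal_basis_of S B"
  shows "finite B" "independent B"
proof -
  have "0 \<notin> B" using assms by (auto simp: orthonormal_basis_of_def)
  then show "independent B" using assms by (simp add: orthonormal_basis_of_def pairwise_orthogonal_independent)
  then show "finite B" by (rule independent_imp_finite)
qed

lemma orthonormal_basis_of_inner:
  assumes "orthonormal_basis_of S B" "a \<in> B" "b \<in> B"
  shows "a \<bullet> b = (if a = b then 1 else 0)"
  using assms by (auto simp: orthonormal_basis_of_def pairwise_def orthogonal_def norm_eq_1)

lemma orthonormal_basis_of_inner_sum:
  assumes "orthonormal_basis_of S B" "b \<in> B"
  shows "(\<Sum>a\<in>B. c a *\<^sub>R a) \<bullet> b = c b"
proof -
  have "(\<Sum>a\<in>B. c a *\<^sub>R a) \<bullet> b = (\<Sum>a\<in>B. if a = b then c b else 0)"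
    unfolding inner_sum_left by (rule sum.cong) (auto simp: orthonormal_basis_of_inner[OF assms(1) _ assms(2)])
  then show ?thesis using assms(2) orthonormal_basis_of_finite(1)[OF assms(1)] by (simp add: sum.delta)
qed

text \<open>For the standard basis this is the product structure of \<open>lborel\<close>. An
  orthogonal map taking that basis to \<open>C\<close> carries it over to any orthonormal
  basis.\<close>

lemma lborel_PiM_orthonormal:
  fixes C :: "'a::euclidean_space set"
  assumes C: "orthonormal_basis_of UNIV C"
  shows "distr (\<Pi>\<^sub>M b\<in>C. lborel) borel (\<lambda>c. \<Sum>b\<in>C. c b *\<^sub>R b) = (lborel :: 'a measure)"
proof -
  interpret product_sigma_finite "\<lambda>_::'a. lborel :: real measure" by standard
  note [simp] = orthonormal_basis_of_finite(1)[OF C]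
  have "card C = DIM('a)"
    using C orthonormal_basis_of_finite(2)[OF C]
    by (metis dim_UNIV dim_eq_card_independent dim_span orthonormal_basis_of_def)
  then obtain \<sigma> where \<sigma>: "bij_betw \<sigma> (Basis :: 'a set) C"
    using finite_same_card_bij[of "Basis :: 'a set" C] by auto
  define f :: "'a \<Rightarrow> 'a" where "f x = (\<Sum>i\<in>Basis. (x \<bullet> i) *\<^sub>R \<sigma> i)" for x
  have f_inner: "f x \<bullet> \<sigma> i = x \<bullet> i" if "i \<in> Basis" for x i
  proof -
    have "f x = (\<Sum>b\<in>C. (x \<bullet> inv_into Basis \<sigma> b) *\<^sub>R b)"
      unfolding f_def using \<sigma> by (intro sum.reindex_bij_betw_not_neutral[of "{}" "{}", simplified] sum.reindex_cong[symmetric, where l=\<sigma>])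
       (auto simp: bij_betw_def)
    then show ?thesis
      using orthonormal_basis_of_inner_sum[OF C, of "\<sigma> i" "\<lambda>b. x \<bullet> inv_into Basis \<sigma> b"] \<sigma> that
      by (auto simp: bij_betw_def)
  qed
  have "f x \<bullet> f y = x \<bullet> y" for x y
    by (subst (2) f_def) (simp add: inner_sum_right f_inner euclidean_inner[of x y] mult.commute)
  moreover have "linear f"
    unfolding f_def by (intro linearI) (simp_all add: inner_add_left scaleR_add_left sum.distrib scaleR_sum_right)
  ultimately have "orthogonal_transformation f"
    by (simp add: orthogonal_transformation_def)
  then have f: "distr lborel borel f = lborel" by (rule distr_lborel_orthogonal)
  have [measurable]: "f \<in> borel_measurable borel" unfolding f_def by measurable
  \<comment> \<open>It suffices to find the joint law of the coordinates
    \<open>x \<bullet> b\<close>. Rotating by \<open>f\<close> turns a box in these coordinates into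
    a box along the standard axes, where the integral factorises.\<close>
  have "distr lborel (\<Pi>\<^sub>M b\<in>C. lborel) (\<lambda>x. \<lambda>b\<in>C. x \<bullet> b) = (\<Pi>\<^sub>M b\<in>C. lborel :: real measure)"
  proof (rule PiM_eqI)
    fix A :: "'a \<Rightarrow> real set" assume "\<And>b. b \<in> C \<Longrightarrow> A b \<in> sets lborel"
    then have A[measurable]: "\<And>b. b \<in> C \<Longrightarrow> A b \<in> sets borel" by simp
    then have A\<sigma>[measurable]: "\<And>i. i \<in> Basis \<Longrightarrow> A (\<sigma> i) \<in> sets borel"
      using \<sigma> by (auto simp: bij_betw_def)
    have "emeasure (distr lborel (\<Pi>\<^sub>M b\<in>C. lborel) (\<lambda>x. \<lambda>b\<in>C. x \<bullet> b)) (Pi\<^sub>E C A)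
        = emeasure lborel {x. \<forall>b\<in>C. x \<bullet> b \<in> A b}"
      by (subst emeasure_distr) (auto intro!: arg_cong2[where f=emeasure] sets_PiM_I_finite)
    also have "\<dots> = emeasure (distr lborel borel f) {x. \<forall>b\<in>C. x \<bullet> b \<in> A b}"
      by (simp add: f)
    also have "\<dots> = emeasure lborel {x. \<forall>b\<in>C. f x \<bullet> b \<in> A b}"
      by (subst emeasure_distr) (auto simp: vimage_def)
    also have "{x. \<forall>b\<in>C. f x \<bullet> b \<in> A b} = {x. \<forall>i\<in>Basis. x \<bullet> i \<in> A (\<sigma> i)}"
      using \<sigma> f_inner by (auto simp: bij_betw_def)
    also have "emeasure lborel \<dots> = (\<integral>\<^sup>+x. (\<Prod>i\<in>Basis. indicator (A (\<sigma> i)) (x \<bullet> i)) \<partial>lborel)"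
    proof (subst nn_integral_indicator[symmetric])
      show "{x. \<forall>i\<in>Basis. x \<bullet> i \<in> A (\<sigma> i)} \<in> sets lborel" by measurable
      show "integral\<^sup>N lborel (indicator {x. \<forall>i\<in>Basis. x \<bullet> i \<in> A (\<sigma> i)}) =
        (\<integral>\<^sup>+x. (\<Prod>i\<in>Basis. indicator (A (\<sigma> i)) (x \<bullet> i)) \<partial>lborel)"
        by (rule nn_integral_cong) (auto simp: indicator_def prod.neutral intro: prod_zero[symmetric])
    qed
    also have "\<dots> = (\<Prod>i\<in>Basis. emeasure lborel (A (\<sigma> i)))"
      by (subst nn_integral_lborel_prod) (auto intro!: prod.cong)
    also have "\<dots> = (\<Prod>b\<in>C. emeasure lborel (A b))"
      using \<sigma> by (rule prod.reindex_bij_betw)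
    finally show "emeasure (distr lborel (\<Pi>\<^sub>M b\<in>C. lborel) (\<lambda>x. \<lambda>b\<in>C. x \<bullet> b)) (Pi\<^sub>E C A) =
      (\<Prod>b\<in>C. emeasure lborel (A b))" .
  qed simp_all
  then have "distr (\<Pi>\<^sub>M b\<in>C. lborel) borel (\<lambda>c. \<Sum>b\<in>C. c b *\<^sub>R b) =
      distr (distr lborel (\<Pi>\<^sub>M b\<in>C. lborel) (\<lambda>x. \<lambda>b\<in>C. x \<bullet> b)) borel (\<lambda>c. \<Sum>b\<in>C. c b *\<^sub>R b)"
    by simp
  also have "\<dots> = distr lborel borel (\<lambda>x. \<Sum>b\<in>C. (x \<bullet> b) *\<^sub>R b)"
    by (subst distr_distr) (auto simp: o_def intro!: distr_cong sum.cong)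
  also have "(\<lambda>x. \<Sum>b\<in>C. (x \<bullet> b) *\<^sub>R b) = (\<lambda>x. x)"
    using C orthonormal_basis_expand[of C] by (auto simp: orthonormal_basis_of_def)
  finally show ?thesis by (simp add: distr_id2)
qed

lemma orthonormal_basis_of_proj:
  assumes B: "orthonormal_basis_of S B" and p: "p \<in> S" and orth: "\<And>s. s \<in> S \<Longrightarrow> (u - p) \<bullet> s = 0"
  shows "p = (\<Sum>b\<in>B. (u \<bullet> b) *\<^sub>R b)"
proof -
  have "b \<in> S" if "b \<in> B" for b using B that span_base by (auto simp: orthonormal_basis_of_def)
  then have "p \<bullet> b = u \<bullet> b" if "b \<in> B" for b using orth that by (simp add: inner_diff_left)
  moreover have "(\<Sum>b\<in>B. (p \<bullet> b) *\<^sub>R b) = p"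
    using B p orthonormal_basis_of_finite(1)[OF B]
    by (intro orthonormal_basis_expand) (auto simp: orthonormal_basis_of_def)
  ultimately show ?thesis by simp
qed

text \<open>The choice inside \<open>lborel_affine\<close> refers to \<open>S\<close> alone, so one
  basis serves all base points \<open>m\<close>.\<close>

lemma lborel_affine_basis:
  fixes S :: "'a::euclidean_space set"
  assumes "subspace S"
  obtains B where "orthonormal_basis_of S B"
    "\<And>m. lborel_affine m S = distr (\<Pi>\<^sub>M b\<in>B. lborel) borel (\<lambda>c. m + (\<Sum>b\<in>B. c b *\<^sub>R b))"
proof -
  define B where "B = (SOME B. pairwise orthogonal B \<and> (\<forall>b\<in>B. norm b = 1) \<and> span B = S)"
  have "orthonormal_basis_of S B"
    unfolding orthonormal_basis_of_def B_def
    by (rule someI_ex) (meson orthonormal_basis_subspace[OF assms])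
  then show thesis by (rule that) (simp add: lborel_affine_def B_def Let_def)
qed

text \<open>
  The constant \<open>k\<close> is the integral of \<open>h\<close> over the orthogonal complement; it may be \<open>0\<close> or \<open>\<infinity>\<close> here
  and is seen to be positive and finite once both sides are probability measures.
\<close>

lemma lborel_affine_split:
  fixes S :: "'a::euclidean_space set" and p :: "'a \<Rightarrow> 'a" and h :: "'a \<Rightarrow> ennreal"
  assumes S: "subspace S" and p: "\<And>u. p u \<in> S" and orth: "\<And>u s. s \<in> S \<Longrightarrow> (u - p u) \<bullet> s = 0"
    and [measurable]: "h \<in> borel_measurable borel"
  obtains k where "\<And>m g. g \<in> borel_measurable borel \<Longrightarrow>
    distr (density lborel (\<lambda>u. g (p u) * h (u - p u))) borel (\<lambda>u. m + p u) =
    density (lborel_affine m S) (\<lambda>z. k * g (z - m))"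
proof -
  interpret product_sigma_finite "\<lambda>_::'a. lborel :: real measure" by standard
  obtain B where B: "orthonormal_basis_of S B"
    and aff: "\<And>m. lborel_affine m S = distr (\<Pi>\<^sub>M b\<in>B. lborel) borel (\<lambda>c. m + (\<Sum>b\<in>B. c b *\<^sub>R b))"
    using lborel_affine_basis[OF S] by blast
  define T where "T = {x. \<forall>s\<in>S. x \<bullet> s = 0}"
  have "subspace T" by (auto simp: T_def subspace_def inner_add_left)
  then obtain B' where B': "orthonormal_basis_of T B'"
    unfolding orthonormal_basis_of_def by (meson orthonormal_basis_subspace)
  have BS: "B \<subseteq> S" and BT: "B' \<subseteq> T"
    using B B' span_superset by (auto simp: orthonormal_basis_of_def)
  note fin[simp] = orthonormal_basis_of_finite(1)[OF B] orthonormal_basis_of_finite(1)[OF B']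
  have perp: "x \<bullet> s = 0" if "x \<in> T" "s \<in> S" for x s using that by (simp add: T_def)
  have disj: "B \<inter> B' = {}"
  proof safe
    fix b assume "b \<in> B" "b \<in> B'"
    then have "b \<bullet> b = 0" using perp BS BT by blast
    then show "b \<in> {}" using \<open>b \<in> B\<close> B by (auto simp: orthonormal_basis_of_def)
  qed
  \<comment> \<open>Joining the bases of \<open>S\<close> and of its orthogonal complement
    \<open>T\<close> presents \<open>lborel\<close> as a product of Lebesgue measures along the two,
    so that Fubini separates \<open>g\<close> from \<open>h\<close>.\<close>
  have C: "orthonormal_basis_of UNIV (B \<union> B')"
    unfolding orthonormal_basis_of_def
  proof (intro conjI)
    show "pairwise orthogonal (B \<union> B')"
    proof (rule pairwiseI)
      fix x y assume "x \<in> B \<union> B'" "y \<in> B \<union> B'" "x \<noteq> y"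
      moreover have "x \<bullet> y = 0" if "x \<in> B" "y \<in> B'" for x y
        using perp[of y x] that BS BT by (auto simp: inner_commute)
      ultimately show "orthogonal x y"
        using orthonormal_basis_of_inner[OF B, of x y] orthonormal_basis_of_inner[OF B', of x y]
        by (auto simp: orthogonal_def) (metis inner_commute)
    qed
    show "\<forall>b\<in>B \<union> B'. norm b = 1" using B B' by (auto simp: orthonormal_basis_of_def)
    have "u \<in> span (B \<union> B')" for u
    proof -
      have "u - p u \<in> span B'" using orth B' by (auto simp: orthonormal_basis_of_def T_def)
      moreover have "p u \<in> span B" using p B by (auto simp: orthonormal_basis_of_def)
      ultimately have "p u + (u - p u) \<in> span (B \<union> B')"
        by (meson in_mono span_add span_mono sup_ge1 sup_ge2)
      then show ?thesis by simp
    qed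
    then show "span (B \<union> B') = UNIV" by auto
  qed
  have p_eq: "p u = (\<Sum>b\<in>B. (u \<bullet> b) *\<^sub>R b)" for u
    by (rule orthonormal_basis_of_proj[OF B p orth])
  have [measurable]: "p \<in> borel_measurable borel" unfolding p_eq[abs_def] by measurable
  define k where "k = (\<integral>\<^sup>+y. h (\<Sum>b\<in>B'. y b *\<^sub>R b) \<partial>(\<Pi>\<^sub>M b\<in>B'. lborel))"
  show thesis
  proof (rule that[of k])
    fix m and g :: "'a \<Rightarrow> ennreal" assume [measurable]: "g \<in> borel_measurable borel"
    show "distr (density lborel (\<lambda>u. g (p u) * h (u - p u))) borel (\<lambda>u. m + p u) =
      density (lborel_affine m S) (\<lambda>z. k * g (z - m))"
    proof (rule measure_eqI)
      show "sets (distr (density lborel (\<lambda>u. g (p u) * h (u - p u))) borel (\<lambda>u. m + p u)) =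
        sets (density (lborel_affine m S) (\<lambda>z. k * g (z - m)))" by (simp add: aff)
      fix A assume "A \<in> sets (distr (density lborel (\<lambda>u. g (p u) * h (u - p u))) borel (\<lambda>u. m + p u))"
      then have [measurable]: "A \<in> sets borel" by simp
      let ?F = "\<lambda>u. g (p u) * h (u - p u) * indicator A (m + p u)"
      let ?\<sigma> = "\<lambda>c. \<Sum>b\<in>B. c b *\<^sub>R b" and ?\<tau> = "\<lambda>c. \<Sum>b\<in>B'. c b *\<^sub>R b"
      have merge: "(\<Sum>b\<in>B \<union> B'. merge B B' (x, y) b *\<^sub>R b) = ?\<sigma> x + ?\<tau> y" for x y :: "'a \<Rightarrow> real"
      proof -
        have "(\<Sum>b\<in>B. merge B B' (x, y) b *\<^sub>R b) = ?\<sigma> x"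
          by (rule sum.cong) (auto simp: merge_def)
        moreover have "(\<Sum>b\<in>B'. merge B B' (x, y) b *\<^sub>R b) = ?\<tau> y"
          using disj by (intro sum.cong) (auto simp: merge_def)
        ultimately show ?thesis using disj by (subst sum.union_disjoint) simp_all
      qed
      have p_sum: "p (?\<sigma> x + ?\<tau> y) = ?\<sigma> x" for x y
      proof -
        have "?\<tau> y \<in> T" using BT \<open>subspace T\<close> by (intro subspace_sum subspace_scale) auto
        then have "(?\<sigma> x + ?\<tau> y) \<bullet> b = x b" if "b \<in> B" for b
          using that BS perp orthonormal_basis_of_inner_sum[OF B] by (auto simp: inner_add_left)
        then show ?thesis by (simp add: p_eq)
      qed
      have "emeasure (distr (density lborel (\<lambda>u. g (p u) * h (u - p u))) borel (\<lambda>u. m + p u)) A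
          = (\<integral>\<^sup>+u. ?F u \<partial>lborel)"
      proof -
        have "(\<lambda>u. m + p u) -` A \<in> sets borel"
          using measurable_sets[of "\<lambda>u. m + p u" borel borel A] by simp
        then show ?thesis
          by (simp add: emeasure_distr emeasure_density indicator_vimage[symmetric] o_def)
            (simp add: indicator_def)
      qed
      also have "\<dots> = (\<integral>\<^sup>+w. ?F (\<Sum>b\<in>B \<union> B'. w b *\<^sub>R b) \<partial>(\<Pi>\<^sub>M b\<in>B \<union> B'. lborel))"
        by (subst lborel_PiM_orthonormal[OF C, symmetric], subst nn_integral_distr) simp_all
      also have "\<dots> = (\<integral>\<^sup>+x. \<integral>\<^sup>+y. ?F (?\<sigma> x + ?\<tau> y) \<partial>(\<Pi>\<^sub>M b\<in>B'. lborel) \<partial>(\<Pi>\<^sub>M b\<in>B. lborel))"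
        by (subst product_nn_integral_fold[OF disj]) (simp_all only: fin merge, measurable)
      also have "\<dots> = (\<integral>\<^sup>+x. (\<integral>\<^sup>+y. g (?\<sigma> x) * indicator A (m + ?\<sigma> x) * h (?\<tau> y) \<partial>(\<Pi>\<^sub>M b\<in>B'. lborel)) \<partial>(\<Pi>\<^sub>M b\<in>B. lborel))"
        by (simp only: p_sum add_diff_cancel_left' mult_ac)
      also have "\<dots> = (\<integral>\<^sup>+x. g (?\<sigma> x) * indicator A (m + ?\<sigma> x) * k \<partial>(\<Pi>\<^sub>M b\<in>B. lborel))"
        by (subst nn_integral_cmult) (simp_all add: k_def)
      also have "\<dots> = emeasure (density (lborel_affine m S) (\<lambda>z. k * g (z - m))) A"
        unfolding aff by (subst emeasure_density) (simp_all add: nn_integral_distr mult_ac)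
      finally show "emeasure (distr (density lborel (\<lambda>u. g (p u) * h (u - p u))) borel (\<lambda>u. m + p u)) A =
        emeasure (density (lborel_affine m S) (\<lambda>z. k * g (z - m))) A" .
    qed
  qed
qed

section \<open>Positive definite matrices and the pseudoinverse\<close>

declare transpose_matrix_vector [simp del]

lemma inner_matrix_vector:
  fixes A :: "real^'n^'m"
  shows "x \<bullet> (A *v y) = (transpose A *v x) \<bullet> y"
  by (simp add: dot_lmul_matrix transpose_matrix_vector)

lemma matrix_diff_ldistrib: "A ** (B - C) = A ** B - A ** (C :: real^'n^'m)"
  by (simp add: matrix_eq matrix_vector_mul_assoc[symmetric] matrix_vector_mult_diff_distrib
      matrix_vector_mult_diff_rdistrib)

lemma matrix_diff_rdistrib: "(A - B) ** C = A ** C - B ** (C :: real^'n^'m)"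
  by (simp add: matrix_eq matrix_vector_mul_assoc[symmetric] matrix_vector_mult_diff_rdistrib)

lemma matrix_add_rdistrib: "(A + B) ** C = A ** C + B ** (C :: real^'n^'m)"
  by (simp add: matrix_eq matrix_vector_mul_assoc[symmetric] matrix_vector_mult_add_rdistrib)

lemma transpose_add: "transpose (A + B) = transpose A + transpose B"
  by (simp add: transpose_def vec_eq_iff)

lemma transpose_diff: "transpose (A - B) = transpose A - transpose B"
  by (simp add: transpose_def vec_eq_iff)

text \<open>The form of A A^T at x is the squared norm of A^T x. This is how (1 - P) A = 0 and P G =
  0 are obtained later, from information about A A^T and G G^T only.\<close>

lemma matrix_mult_transpose_self_eq_0:
  fixes A :: "real^'n^'m"
  assumes "A ** transpose A = 0"
  shows "A = 0"
proof -
  have "(transpose A *v x) \<bullet> (transpose A *v x) = 0" for x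
    using assms by (simp add: inner_matrix_vector matrix_vector_mul_assoc)
  then have "transpose A = 0" by (simp add: matrix_eq)
  then have "transpose (transpose A) = transpose 0" by simp
  then show ?thesis by (simp add: transpose_def vec_eq_iff)
qed

lemma matrix_inv:
  fixes A :: "'a::semiring_1^'n^'m"
  assumes "invertible A"
  shows "A ** matrix_inv A = mat 1" "matrix_inv A ** A = mat 1"
  using someI_ex[OF assms[unfolded invertible_def]] by (simp_all add: matrix_inv_def)

lemma matrix_inv_unique:
  fixes A :: "real^'n^'n"
  assumes "A ** B = mat 1"
  shows "matrix_inv A = B"
proof -
  have "invertible A" using assms invertible_right_inverse by blast
  then have "matrix_inv A ** (A ** B) = B" by (simp add: matrix_mul_assoc matrix_inv)
  then show ?thesis by (simp add: assms)
qed

lemma matrix_inv_symmetric: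
  fixes A :: "real^'n^'n"
  assumes "invertible A" "transpose A = A"
  shows "transpose (matrix_inv A) = matrix_inv A"
proof -
  have "transpose (matrix_inv A ** A) = mat 1" using assms by (simp add: matrix_inv)
  then show ?thesis using assms by (metis matrix_transpose_mul matrix_inv_unique)
qed

lemma pos_def_invertible:
  assumes "pos_def A"
  shows "invertible A"
proof -
  have "x = 0" if "A *v x = 0" for x
    using assms that unfolding pos_def_def by (metis inner_zero_right less_irrefl)
  then show ?thesis
    by (auto simp: invertible_left_inverse matrix_left_invertible_ker)
qed

lemma pos_def_matrix_inv:
  fixes A :: "real^'n^'n"
  assumes "pos_def A"
  shows "pos_def (matrix_inv A)"
  unfolding pos_def_def
proof (intro conjI allI impI)
  note inv = matrix_inv[OF pos_def_invertible[OF assms]]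
  have A: "transpose A = A" using assms by (simp add: pos_def_def)
  then show "transpose (matrix_inv A) = matrix_inv A"
    using assms by (simp add: matrix_inv_symmetric pos_def_invertible)
  fix x :: "real^'n" assume "x \<noteq> 0"
  let ?y = "matrix_inv A *v x"
  have x: "A *v ?y = x" by (simp add: matrix_vector_mul_assoc inv)
  then have "?y \<noteq> 0" using \<open>x \<noteq> 0\<close> by auto
  then have "0 < ?y \<bullet> (A *v ?y)" using assms by (simp add: pos_def_def)
  then show "0 < x \<bullet> ?y" by (simp add: x inner_commute)
qed

text \<open>Gram--Schmidt for the form \<open>W\<close>, which replaces the square root of \<open>W\<close>.\<close>

lemma pos_def_conjugate_basis_partial:
  fixes W :: "real^'n^'n"
  assumes "pos_def W" and "finite (I :: 'n set)"
  shows "\<exists>v. \<forall>i\<in>I. \<forall>j\<in>I. v i \<bullet> (W *v v j) = (if i = j then 1 else (0::real))"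
  using assms(2)
proof (induction I rule: finite_induct)
  case (insert a I)
  then obtain v where v: "\<And>i j. i \<in> I \<Longrightarrow> j \<in> I \<Longrightarrow> v i \<bullet> (W *v v j) = (if i = j then 1 else 0)"
    by blast
  have W: "transpose W = W" using assms by (simp add: pos_def_def)
  \<comment> \<open>The index \<open>a\<close> is not yet used, so the vectors W v_i are fewer than
    the dimension and some nonzero \<open>w\<close> is orthogonal to all of them. Such a
    \<open>w\<close> is W-orthogonal to every v_i and only has to be rescaled.\<close>
  have "dim ((\<lambda>i. W *v v i) ` I) \<le> card I"
    by (rule order.trans[OF dim_le_card']) (auto intro: card_image_le insert.hyps)
  also have "\<dots> < card (insert a I)" using insert.hyps by simp
  also have "\<dots> \<le> DIM(real^'n)" by (simp add: card_mono)
  finally obtain w where w: "w \<noteq> 0" "\<And>y. y \<in> span ((\<lambda>i. W *v v i) ` I) \<Longrightarrow> orthogonal w y"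
    using orthogonal_to_subspace_exists by blast
  have wv: "w \<bullet> (W *v v i) = 0" "v i \<bullet> (W *v w) = 0" if "i \<in> I" for i
  proof -
    show "w \<bullet> (W *v v i) = 0" using w(2) that by (simp add: span_base orthogonal_def)
    then show "v i \<bullet> (W *v w) = 0" by (metis W inner_commute inner_matrix_vector)
  qed
  have pos: "0 < w \<bullet> (W *v w)" using assms w(1) by (simp add: pos_def_def)
  define u where "u = (1 / sqrt (w \<bullet> (W *v w))) *\<^sub>R w"
  have "u \<bullet> (W *v u) = 1"
    using pos by (simp add: u_def matrix_vector_mult_scaleR)
  moreover have "u \<bullet> (W *v v i) = 0" "v i \<bullet> (W *v u) = 0" if "i \<in> I" for i
    using wv[OF that] by (simp_all add: u_def matrix_vector_mult_scaleR)
  ultimately have "\<forall>i\<in>insert a I. \<forall>j\<in>insert a I.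
      (v(a := u)) i \<bullet> (W *v (v(a := u)) j) = (if i = j then 1 else 0)"
    using v insert.hyps by auto
  then show ?case by blast
qed simp

text \<open>The columns of \<open>V\<close> are a W-orthonormal family indexed by all of
  \<open>'n\<close>; the identity lists their mutual W-products.\<close>

lemma pos_def_factor:
  fixes W :: "real^'n^'n"
  assumes "pos_def W"
  obtains V :: "real^'n^'n" where "transpose V ** W ** V = mat 1"
proof -
  obtain v :: "'n \<Rightarrow> real^'n" where v: "\<And>i j. v i \<bullet> (W *v v j) = (if i = j then 1 else (0::real))"
    using pos_def_conjugate_basis_partial[OF assms finite[of UNIV]] by (metis UNIV_I)
  define V :: "real^'n^'n" where "V = (\<chi> k i. v i $ k)"
  have "V *v axis i 1 = v i" for i
    by (simp add: V_def matrix_vector_mult_basis column_def vec_eq_iff)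
  then have "axis i 1 \<bullet> ((transpose V ** W ** V) *v axis j 1) = v i \<bullet> (W *v v j)" for i j
    by (simp add: matrix_vector_mul_assoc[symmetric] inner_matrix_vector[of _ "transpose V"])
  then have "transpose V ** W ** V = mat 1"
    by (simp add: v vec_eq_iff mat_def inner_axis' matrix_vector_mult_basis column_def)
  then show thesis by (rule that)
qed

section \<open>Orthogonal projections as matrices\<close>

definition orth_proj :: "real^'n^'n \<Rightarrow> (real^'n) set \<Rightarrow> bool" where
  "orth_proj P S \<longleftrightarrow> transpose P = P \<and> P ** P = P \<and> range ((*v) P) = S"

lemma orth_projD:
  assumes "orth_proj P S"
  shows "transpose P = P" "P ** P = P" "P *v (P *v x) = P *v x" "P *v x \<in> S"
    "x \<in> S \<Longrightarrow> P *v x = x" "x \<in> S \<Longrightarrow> (u - P *v u) \<bullet> x = 0" "subspace S"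
proof -
  show P: "transpose P = P" "P ** P = P" using assms by (auto simp: orth_proj_def)
  then show idem: "P *v (P *v x) = P *v x" for x by (simp add: matrix_vector_mul_assoc)
  show "P *v x \<in> S" "subspace S" using assms by (auto simp: orth_proj_def subspace_UNIV
        intro!: linear_subspace_image)
  show fixed: "P *v x = x" if "x \<in> S" for x using assms that idem by (auto simp: orth_proj_def)
  show "(u - P *v u) \<bullet> x = 0" if "x \<in> S"
    using fixed[OF that] inner_matrix_vector[of u P x] P(1) by (simp add: inner_diff_left)
qed

lemma orth_proj_exists:
  fixes S :: "(real^'n) set"
  assumes "subspace S"
  obtains P where "orth_proj P S"
proof -
  obtain B where B: "orthonormal_basis_of S B"
    unfolding orthonormal_basis_of_def by (meson orthonormal_basis_subspace[OF assms])
  define p where "p x = (\<Sum>b\<in>B. (x \<bullet> b) *\<^sub>R b)" for x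
  have "linear p"
    unfolding p_def by (intro linearI) (simp_all add: inner_add_left scaleR_add_left sum.distrib scaleR_sum_right)
  then have P: "matrix p *v x = p x" for x by (simp add: matrix_works)
  have p_S: "p x \<in> S" for x
    unfolding p_def using B span_superset[of B] assms
    by (intro subspace_sum subspace_scale) (auto simp: orthonormal_basis_of_def)
  have p_id: "p x = x" if "x \<in> S" for x
    using orthonormal_basis_of_proj[OF B that, of x] by (simp add: p_def)
  have "orth_proj (matrix p) S"
    unfolding orth_proj_def
  proof (intro conjI)
    show "matrix p ** matrix p = matrix p"
      by (simp add: matrix_eq matrix_vector_mul_assoc[symmetric] P p_id p_S)
    show "range ((*v) (matrix p)) = S"
    proof
      show "range ((*v) (matrix p)) \<subseteq> S" using p_S by (auto simp: P)
      show "S \<subseteq> range ((*v) (matrix p))" by (metis P p_id rangeI subsetI)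
    qed
    have "p x \<bullet> y = x \<bullet> p y" for x y
      by (simp add: p_def inner_sum_left inner_sum_right mult.commute inner_commute)
    then have "(transpose (matrix p) *v x) \<bullet> y = (matrix p *v x) \<bullet> y" for x y
      by (simp add: inner_matrix_vector[symmetric] P)
    then show "transpose (matrix p) = matrix p" by (metis matrix_eq vector_eq_rdot)
  qed
  then show thesis by (rule that)
qed

text \<open>
  \<open>G\<close> maps the kernel of \<open>A\<close> isometrically onto the complement of its range, so that \<open>A + G\<close> is an
  invertible square root of \<open>A A\<^sup>T + (1 - P)\<close>.
\<close>

lemma complementary_isometry:
  fixes A :: "real^'n^'n"
  assumes P: "orth_proj P (range ((*v) A))"
  obtains G where "A ** transpose G = 0" "G ** transpose G = mat 1 - P"
proof -
  define S T where "S = range ((*v) A)" and "T = range ((*v) (transpose A))"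
  define S' T' where "S' = {y \<in> UNIV. \<forall>x\<in>S. orthogonal x y}" and "T' = {y \<in> UNIV. \<forall>x\<in>T. orthogonal x y}"
  have sub: "subspace S" "subspace T" unfolding S_def T_def
    by (auto intro!: linear_subspace_image)
  \<comment> \<open>Row rank equals column rank. Hence the complement of the range of
    \<open>A\<close> and that of the range of A^T, which is the kernel of \<open>A\<close>, have
    equal dimension and their orthonormal bases can be matched.\<close>
  have "dim S = dim T" by (simp add: S_def T_def rank_dim_range[symmetric] rank_transpose)
  then have dim: "dim S' = dim T'"
    using dim_subspace_orthogonal_to_vectors[OF sub(1) subspace_UNIV]
      dim_subspace_orthogonal_to_vectors[OF sub(2) subspace_UNIV] by (simp add: S'_def T'_def)
  have sub': "subspace S'" "subspace T'"
    by (auto simp: S'_def T'_def subspace_def orthogonal_def inner_add_right)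
  obtain B C where B: "orthonormal_basis_of S' B" and C: "orthonormal_basis_of T' C"
    unfolding orthonormal_basis_of_def
    by (meson orthonormal_basis_subspace[OF sub'(1)] orthonormal_basis_subspace[OF sub'(2)])
  note fin = orthonormal_basis_of_finite[OF B] orthonormal_basis_of_finite[OF C]
  have "card B = card C"
    using dim B C fin by (metis dim_eq_card_independent dim_span orthonormal_basis_of_def)
  then obtain \<tau> where \<tau>: "bij_betw \<tau> C B"
    using finite_same_card_bij fin by metis
  \<comment> \<open>\<open>g\<close> sends the basis \<open>C\<close> of the kernel to the basis
    \<open>B\<close> and annihilates the complement of the kernel; \<open>g'\<close> is its
    adjoint.\<close>
  define g g' where "g x = (\<Sum>c\<in>C. (x \<bullet> c) *\<^sub>R \<tau> c)" and "g' y = (\<Sum>c\<in>C. (y \<bullet> \<tau> c) *\<^sub>R c)" for x y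
  have "linear g"
    unfolding g_def by (intro linearI) (simp_all add: inner_add_left scaleR_add_left sum.distrib scaleR_sum_right)
  then have G: "matrix g *v x = g x" for x by (simp add: matrix_works)
  have "g x \<bullet> y = x \<bullet> g' y" for x y
    by (simp add: g_def g'_def inner_sum_left inner_sum_right mult.commute inner_commute)
  then have "(transpose (matrix g) *v x) \<bullet> y = g' x \<bullet> y" for x y
    by (metis G inner_commute inner_matrix_vector)
  then have G': "transpose (matrix g) *v x = g' x" for x by (metis vector_eq_rdot)
  show thesis
  proof (rule that[of "matrix g"])
    have "A *v c = 0" if "c \<in> C" for c
    proof -
      have "c \<in> T'" using that C span_base by (auto simp: orthonormal_basis_of_def)
      then have "x \<bullet> (A *v c) = 0" for x
        by (simp add: inner_matrix_vector T'_def T_def orthogonal_def)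
      then show ?thesis by (metis inner_eq_zero_iff)
    qed
    then have "A *v g' x = 0" for x
      by (simp add: g'_def linear_sum[OF matrix_vector_mul_linear] matrix_vector_mult_scaleR)
    then show "A ** transpose (matrix g) = 0"
      by (simp add: matrix_eq matrix_vector_mul_assoc[symmetric] G')
    have "g (g' y) = y - P *v y" for y
    proof -
      have "g (g' y) = (\<Sum>c\<in>C. (y \<bullet> \<tau> c) *\<^sub>R \<tau> c)"
        unfolding g_def by (rule sum.cong) (auto simp: g'_def orthonormal_basis_of_inner_sum[OF C])
      also have "\<dots> = (\<Sum>b\<in>B. (y \<bullet> b) *\<^sub>R b)"
        using \<tau> by (rule sum.reindex_bij_betw)
      also have "\<dots> = y - P *v y"
      proof (rule orthonormal_basis_of_proj[OF B, symmetric])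
        show "y - P *v y \<in> S'"
          using orth_projD(6)[OF P] by (simp add: S'_def S_def orthogonal_def inner_commute)
        show "(y - (y - P *v y)) \<bullet> s = 0" if "s \<in> S'" for s
          using that orth_projD(4)[OF P, of y] by (auto simp: S'_def S_def orthogonal_def)
      qed
      finally show ?thesis .
    qed
    then show "matrix g ** transpose (matrix g) = mat 1 - P"
      by (simp add: matrix_eq matrix_vector_mul_assoc[symmetric] G G' matrix_vector_mult_diff_rdistrib)
  qed
qed

text \<open>\<open>pinv\<close> is a definite description, so uniqueness is what makes it
  computable. For two candidates the symmetric products A X and A Y absorb each other and hence
  agree, likewise X A and Y A; then Y = Y A Y = X A X = X.\<close>

lemma pinv_eqI:
  fixes A :: "real^'n^'m"
  assumes "A ** X ** A = A" "X ** A ** X = X" "transpose (A ** X) = A ** X" "transpose (X ** A) = X ** A"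
  shows "pinv A = X"
  unfolding pinv_def
proof (rule the_equality)
  fix Y assume Y: "A ** Y ** A = A \<and> Y ** A ** Y = Y \<and>
     transpose (A ** Y) = A ** Y \<and> transpose (Y ** A) = Y ** A"
  have "A ** Y = transpose (A ** X ** A ** Y)" using Y assms by simp
  also have "\<dots> = transpose (A ** Y) ** transpose (A ** X)"
    by (simp add: matrix_transpose_mul[symmetric] matrix_mul_assoc)
  also have "\<dots> = A ** X" using Y assms by (simp add: matrix_mul_assoc)
  finally have AY: "A ** Y = A ** X" .
  have "Y ** A = transpose (Y ** (A ** X ** A))" using Y assms by simp
  also have "\<dots> = transpose (X ** A) ** transpose (Y ** A)"
    by (simp add: matrix_transpose_mul[symmetric] matrix_mul_assoc)
  also have "\<dots> = (X ** A) ** (Y ** A)" using Y assms by simp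
  also have "\<dots> = X ** (A ** Y ** A)" by (simp only: matrix_mul_assoc)
  also have "\<dots> = X ** A" using Y by simp
  finally have YA: "Y ** A = X ** A" .
  have "Y = Y ** A ** Y" using Y by simp
  also have "\<dots> = X ** A ** Y" by (simp add: YA)
  also have "\<dots> = X ** (A ** X)" using AY by (simp add: matrix_mul_assoc[symmetric])
  also have "\<dots> = X" using assms by (simp add: matrix_mul_assoc)
  finally show "Y = X" .
qed (use assms in simp)

text \<open>The form at v is |A^T v|^2 + |v - P v|^2. If both terms vanish, v lies in the kernel and
  in the range of the symmetric matrix \<open>K\<close>, so it is orthogonal to itself.\<close>

lemma psd_regularized_pos_def:
  fixes A :: "real^'n^'n"
  assumes K: "K = A ** transpose A" and P: "orth_proj P (range ((*v) K))"
  shows "pos_def (K + (mat 1 - P))"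
  unfolding pos_def_def
proof (intro conjI allI impI)
  have Kt: "transpose K = K" by (simp add: K matrix_transpose_mul)
  show "transpose (K + (mat 1 - P)) = K + (mat 1 - P)"
    by (simp add: transpose_add transpose_diff Kt orth_projD(1)[OF P])
  fix v :: "real^'n" assume "v \<noteq> 0"
  have K_form: "v \<bullet> (K *v v) = norm (transpose A *v v) ^ 2"
    by (simp add: K matrix_vector_mul_assoc[symmetric] inner_matrix_vector power2_norm_eq_inner)
  have "v \<bullet> (v - P *v v) = (v - P *v v) \<bullet> (v - P *v v)"
    using orth_projD(6)[OF P orth_projD(4)[OF P], of v v]
    by (simp add: inner_diff_left inner_diff_right inner_commute)
  then have form: "v \<bullet> ((K + (mat 1 - P)) *v v) = norm (transpose A *v v) ^ 2 + norm (v - P *v v) ^ 2"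
    using K_form by (simp add: matrix_vector_mult_add_rdistrib matrix_vector_mult_diff_rdistrib
        inner_add_right power2_norm_eq_inner)
  have "transpose A *v v \<noteq> 0 \<or> v - P *v v \<noteq> 0"
  proof (rule ccontr)
    assume "\<not> ?thesis"
    then have "K *v v = 0" "P *v v = v" by (simp_all add: K matrix_vector_mul_assoc[symmetric])
    then obtain w where "v = K *v w" using orth_projD(4)[OF P, of v] by auto
    then have "v \<bullet> v = 0" using \<open>K *v v = 0\<close> Kt
      by (metis inner_matrix_vector inner_zero_left)
    then show False using \<open>v \<noteq> 0\<close> by simp
  qed
  then show "0 < v \<bullet> ((K + (mat 1 - P)) *v v)"
    unfolding form by (auto intro: add_pos_nonneg add_nonneg_pos)
qed

text \<open>The regularised matrix is block diagonal: \<open>K\<close> on S and the identity on the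
  complement. Its inverse \<open>Li\<close> therefore commutes with \<open>P\<close>, and K Li = Li
  K = P, from which Li P satisfies the Penrose conditions.\<close>

lemma pinv_psd:
  fixes A :: "real^'n^'n"
  assumes K: "K = A ** transpose A" and P: "orth_proj P (range ((*v) K))"
  shows "matrix_inv (K + (mat 1 - P)) = pinv K + (mat 1 - P)"
    "pinv K ** P = pinv K" "P ** pinv K = pinv K" "transpose (pinv K) = pinv K"
    "K ** pinv K = P"
proof -
  let ?L = "K + (mat 1 - P)"
  define Li where "Li = matrix_inv ?L"
  note PD = orth_projD[OF P]
  have L: "invertible ?L" using psd_regularized_pos_def[OF assms] by (rule pos_def_invertible)
  have Kt: "transpose K = K" by (simp add: K matrix_transpose_mul)
  have PK: "P ** K = K" using PD(5) by (simp add: matrix_eq matrix_vector_mul_assoc[symmetric])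
  have KP: "K ** P = K" using arg_cong[OF PK, of transpose] by (simp add: matrix_transpose_mul Kt PD)
  have Lt: "transpose ?L = ?L" by (simp add: transpose_add transpose_diff Kt PD)
  have Lit: "transpose Li = Li" unfolding Li_def by (rule matrix_inv_symmetric[OF L Lt])
  have inv: "?L ** Li = mat 1" "Li ** ?L = mat 1" using matrix_inv[OF L] by (simp_all add: Li_def)
  have LP: "?L ** P = K" by (simp add: matrix_add_rdistrib matrix_diff_rdistrib KP PD)
  have PL: "P ** ?L = K" by (simp add: matrix_add_ldistrib matrix_diff_ldistrib PK PD)
  have LiK: "Li ** K = P"
  proof -
    have "Li ** K = (Li ** ?L) ** P" by (simp only: LP matrix_mul_assoc[symmetric])
    then show ?thesis by (simp only: inv matrix_mul_lid)
  qed
  have KLi: "K ** Li = P"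
  proof -
    have "K ** Li = P ** (?L ** Li)" by (simp only: PL matrix_mul_assoc)
    then show ?thesis by (simp only: inv matrix_mul_rid)
  qed
  have comm: "Li ** P = P ** Li"
  proof -
    have "Li ** P = Li ** P ** (?L ** Li)" by (simp only: inv matrix_mul_rid)
    also have "\<dots> = Li ** (P ** ?L) ** Li" by (simp only: matrix_mul_assoc)
    also have "\<dots> = P ** Li" by (simp only: PL LiK)
    finally show ?thesis .
  qed
  have X: "pinv K = Li ** P"
  proof (rule pinv_eqI)
    have 1: "K ** (Li ** P) = P" using KLi PD by (simp add: matrix_mul_assoc)
    have 2: "(Li ** P) ** K = P" using LiK PK by (simp add: matrix_mul_assoc[symmetric])
    show "K ** (Li ** P) ** K = K" by (simp only: 1 PK)
    show "(Li ** P) ** K ** (Li ** P) = Li ** P" by (simp only: 2) (simp add: comm matrix_mul_assoc PD)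
    show "transpose (K ** (Li ** P)) = K ** (Li ** P)" by (simp only: 1 PD)
    show "transpose (Li ** P ** K) = Li ** P ** K" by (simp only: 2 PD)
  qed
  show "pinv K ** P = pinv K" by (simp add: X matrix_mul_assoc[symmetric] PD)
  show "P ** pinv K = pinv K" by (simp add: X comm matrix_mul_assoc PD)
  show "transpose (pinv K) = pinv K" by (simp add: X matrix_transpose_mul PD Lit comm)
  show "K ** pinv K = P" by (simp add: X matrix_mul_assoc KLi PD)
  have "?L ** pinv K = P" by (simp only: X matrix_mul_assoc inv matrix_mul_lid)
  then have "?L ** (pinv K + (mat 1 - P)) = P + ?L ** (mat 1 - P)" by (simp only: matrix_add_ldistrib)
  also have "\<dots> = mat 1"
    by (simp add: matrix_add_rdistrib matrix_diff_ldistrib matrix_diff_rdistrib KP PD)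
  finally show "matrix_inv ?L = pinv K + (mat 1 - P)" by (rule matrix_inv_unique)
qed

text \<open>In (A + G)(A + G)^T the cross terms vanish, which leaves the regularised
  \<open>K\<close>. So V^T times the inverse of that matrix is a right inverse of the square matrix
  V = A + G, hence also a left inverse.\<close>

lemma psd_factor_invertible:
  fixes A :: "real^'n^'n"
  assumes K: "K = A ** transpose A" and P: "orth_proj P (range ((*v) K))"
  obtains V :: "real^'n^'n" where "P ** V = A" "transpose V ** (pinv K + (mat 1 - P)) ** V = mat 1"
proof -
  note PD = orth_projD[OF P]
  have Kt: "transpose K = K" by (simp add: K matrix_transpose_mul)
  have PK: "P ** K = K" using PD(5) by (simp add: matrix_eq matrix_vector_mul_assoc[symmetric])
  have KP: "K ** P = K" using arg_cong[OF PK, of transpose] by (simp add: matrix_transpose_mul Kt PD)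
  \<comment> \<open>This product vanishes, so the columns of \<open>A\<close> lie in the range of
    \<open>K\<close>. The two ranges thus coincide, and the isometry built for \<open>A\<close> has
    the complement of Range(K) as its target.\<close>
  have "((mat 1 - P) ** A) ** transpose ((mat 1 - P) ** A) = (mat 1 - P) ** K ** (mat 1 - P)"
    by (simp add: matrix_transpose_mul transpose_diff PD K matrix_mul_assoc)
  also have "\<dots> = 0" by (simp add: matrix_diff_rdistrib matrix_diff_ldistrib PK)
  finally have "(mat 1 - P) ** A = 0" by (rule matrix_mult_transpose_self_eq_0)
  then have PA: "P ** A = A" by (simp add: matrix_diff_rdistrib)
  have "range ((*v) A) = range ((*v) K)"
  proof
    show "range ((*v) A) \<subseteq> range ((*v) K)"
    proof
      fix y assume "y \<in> range ((*v) A)"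
      then have "y = P *v y" by (auto simp: matrix_vector_mul_assoc PA)
      then show "y \<in> range ((*v) K)" by (metis PD(4))
    qed
    show "range ((*v) K) \<subseteq> range ((*v) A)" by (auto simp: K matrix_vector_mul_assoc[symmetric])
  qed
  then obtain G where G: "A ** transpose G = 0" "G ** transpose G = mat 1 - P"
    using complementary_isometry[of P A] P by metis
  have "(P ** G) ** transpose (P ** G) = P ** (mat 1 - P) ** P"
    by (simp add: matrix_transpose_mul PD G(2)[symmetric] matrix_mul_assoc)
  also have "\<dots> = 0" by (simp add: matrix_diff_ldistrib PD)
  finally have PG: "P ** G = 0" by (rule matrix_mult_transpose_self_eq_0)
  have G': "G ** transpose A = 0"
    using arg_cong[OF G(1), of transpose] by (simp add: matrix_transpose_mul) (simp add: transpose_def vec_eq_iff)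
  let ?V = "A + G" and ?L = "K + (mat 1 - P)"
  have VV: "?V ** transpose ?V = ?L"
    by (simp add: transpose_add matrix_add_ldistrib matrix_add_rdistrib G G' K)
  note inv = matrix_inv[OF pos_def_invertible[OF psd_regularized_pos_def[OF assms]]]
  let ?M = "transpose ?V ** matrix_inv ?L"
  have "?V ** ?M = mat 1" by (simp add: matrix_mul_assoc VV inv)
  then have "?M ** ?V = mat 1" using matrix_left_right_inverse by blast
  moreover have "P ** ?V = A" by (simp add: matrix_add_ldistrib PA PG)
  ultimately show thesis using that[of ?V] by (simp add: pinv_psd(1)[OF assms])
qed

text \<open>With y the image of x under \<open>pinv K\<close>, one has P x = K y, so the form equals
  y \<bullet> K y = |A^T y|^2. If it vanishes then P x = 0, which excludes nonzero x in the
  range.\<close>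

lemma pinv_psd_pos:
  fixes A :: "real^'n^'n"
  assumes K: "K = A ** transpose A" and P: "orth_proj P (range ((*v) K))"
  shows "0 \<le> x \<bullet> (pinv K *v x)" "x \<in> range ((*v) K) \<Longrightarrow> x \<noteq> 0 \<Longrightarrow> 0 < x \<bullet> (pinv K *v x)"
proof -
  note X = pinv_psd[OF assms]
  let ?y = "pinv K *v x"
  have "x \<bullet> ?y = (P *v x) \<bullet> ?y"
    using X(3) orth_projD(1)[OF P] by (metis inner_matrix_vector matrix_vector_mul_assoc)
  also have "\<dots> = (K *v ?y) \<bullet> ?y" by (simp add: matrix_vector_mul_assoc X)
  also have "\<dots> = ?y \<bullet> (K *v ?y)" by (rule inner_commute)
  also have "\<dots> = ?y \<bullet> (A *v (transpose A *v ?y))"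
    using matrix_vector_mul_assoc[of A "transpose A" ?y] K by metis
  also have "\<dots> = norm (transpose A *v ?y) ^ 2"
    by (subst inner_matrix_vector) (rule power2_norm_eq_inner[symmetric])
  finally have form: "x \<bullet> ?y = norm (transpose A *v ?y) ^ 2" .
  then show "0 \<le> x \<bullet> ?y" by simp
  assume x: "x \<in> range ((*v) K)" "x \<noteq> 0"
  have "transpose A *v ?y \<noteq> 0"
  proof
    assume "transpose A *v ?y = 0"
    then have "A *v (transpose A *v ?y) = 0" by simp
    then have "(K ** pinv K) *v x = 0" by (metis K matrix_vector_mul_assoc)
    then show False using x orth_projD(5)[OF P x(1)] by (simp add: X)
  qed
  then show "0 < x \<bullet> ?y" by (simp add: form)
qed

text \<open>\<open>Q\<close> is controlled on \<open>S\<close> only. Compressing it there and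
  putting the identity on the complement gives a form definite everywhere, so that a problem
  restricted to \<open>S\<close> is solved by an ordinary matrix inverse.\<close>

lemma compressed_form_pos_def:
  fixes Q :: "real^'n^'n"
  assumes P: "orth_proj P S" and Q: "transpose Q = Q"
    and pos: "\<And>x. x \<in> S \<Longrightarrow> x \<noteq> 0 \<Longrightarrow> 0 < x \<bullet> (Q *v x)"
  shows "pos_def (P ** Q ** P + (mat 1 - P))"
  unfolding pos_def_def
proof (intro conjI allI impI)
  note PD = orth_projD[OF P]
  show "transpose (P ** Q ** P + (mat 1 - P)) = P ** Q ** P + (mat 1 - P)"
    by (simp add: transpose_add transpose_diff matrix_transpose_mul matrix_mul_assoc PD Q)
  fix v :: "real^'n" assume "v \<noteq> 0"
  have "v \<bullet> (v - P *v v) = norm (v - P *v v) ^ 2"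
    using PD(6)[OF PD(4), of v v]
    by (simp add: inner_diff_left inner_diff_right inner_commute power2_norm_eq_inner)
  moreover have "v \<bullet> ((P ** Q ** P) *v v) = (P *v v) \<bullet> (Q *v (P *v v))"
    by (simp add: matrix_vector_mul_assoc[symmetric] inner_matrix_vector[of _ P] PD)
  ultimately have form: "v \<bullet> ((P ** Q ** P + (mat 1 - P)) *v v) =
      (P *v v) \<bullet> (Q *v (P *v v)) + norm (v - P *v v) ^ 2"
    by (simp add: matrix_vector_mult_add_rdistrib matrix_vector_mult_diff_rdistrib inner_add_right)
  show "0 < v \<bullet> ((P ** Q ** P + (mat 1 - P)) *v v)"
  proof (cases "P *v v = 0")
    case True
    then show ?thesis using \<open>v \<noteq> 0\<close> unfolding form by simp
  next
    case False
    then show ?thesis unfolding form using pos[OF PD(4) False] by (intro add_pos_nonneg) auto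
  qed
qed

lemma compressed_form_eq:
  fixes Q :: "real^'n^'n"
  assumes P: "orth_proj P S" and x: "x \<in> S"
  shows "(P ** Q ** P + (mat 1 - P)) *v x = P *v (Q *v x)"
  using orth_projD(5)[OF assms]
  by (simp add: matrix_vector_mult_add_rdistrib matrix_vector_mult_diff_rdistrib matrix_vector_mul_assoc[symmetric])

text \<open>The compressed matrix is the identity on the complement of \<open>S\<close>, so the
  solution inherits from P b a vanishing component there.\<close>

lemma compressed_form_solution:
  fixes Q :: "real^'n^'n" and b :: "real^'n"
  assumes P: "orth_proj P S" and inv: "invertible (P ** Q ** P + (mat 1 - P))"
  defines "x \<equiv> matrix_inv (P ** Q ** P + (mat 1 - P)) *v (P *v b)"
  shows "x \<in> S" "P *v (Q *v x) = P *v b"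
proof -
  note PD = orth_projD[OF P]
  let ?W = "P ** Q ** P + (mat 1 - P)"
  have W: "?W *v x = P *v b"
    by (simp add: x_def matrix_vector_mul_assoc matrix_mul_assoc matrix_inv[OF inv])
  have "P *v (?W *v x) = (P ** Q ** P) *v x"
    by (simp add: matrix_vector_mul_assoc matrix_add_ldistrib matrix_diff_ldistrib matrix_mul_assoc PD)
  then have "x - P *v x = ?W *v x - P *v (?W *v x)"
    by (simp add: matrix_vector_mult_add_rdistrib matrix_vector_mult_diff_rdistrib)
  then have "x = P *v x" by (simp add: W PD)
  then show "x \<in> S" by (metis PD(4))
  then show "P *v (Q *v x) = P *v b" using W compressed_form_eq[OF P] by metis
qed

text \<open>Only the projected equation for \<open>s\<close> is available. It is enough, because the
  cross terms pair Q s with vectors of \<open>S\<close>, and these do not see what \<open>P\<close>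
  removes.\<close>

lemma complete_square:
  fixes Q :: "real^'n^'n"
  assumes P: "orth_proj P S" and Q: "transpose Q = Q"
    and x: "x \<in> S" and s: "s \<in> S" "P *v (Q *v s) = P *v b"
  shows "1/2 * (x \<bullet> (Q *v x)) - b \<bullet> x = 1/2 * (s \<bullet> (Q *v s)) - b \<bullet> s
    + 1/2 * ((x - s) \<bullet> (Q *v (x - s)))"
proof -
  have eq: "v \<bullet> (Q *v s) = v \<bullet> b" if "v \<in> S" for v
    using that s orth_projD(1,5)[OF P] by (metis inner_matrix_vector)
  have sym: "x \<bullet> (Q *v s) = s \<bullet> (Q *v x)" by (metis Q inner_commute inner_matrix_vector)
  show ?thesis
    using eq[OF x] eq[OF s(1)] sym
    by (simp add: matrix_vector_mult_diff_distrib inner_diff_left inner_diff_right inner_commute algebra_simps)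
qed

section \<open>Gaussian laws\<close>

lemma nn_integral_lborel_vec_prod:
  fixes g :: "'n::finite \<Rightarrow> real \<Rightarrow> ennreal"
  assumes [measurable]: "\<And>i. g i \<in> borel_measurable borel"
  shows "(\<integral>\<^sup>+z. (\<Prod>i\<in>UNIV. g i (z $ i)) \<partial>(lborel :: (real^'n) measure)) = (\<Prod>i\<in>UNIV. \<integral>\<^sup>+x. g i x \<partial>lborel)"
proof -
  define ax :: "'n \<Rightarrow> real^'n" where "ax i = axis i 1" for i
  have inj: "inj ax" by (auto simp: ax_def inj_def axis_eq_axis)
  have bij: "bij_betw ax UNIV Basis"
    using inj by (auto simp: bij_betw_def Basis_vec_def ax_def)
  have inv: "inv ax (ax i) = i" for i using inj by simp
  have "(\<integral>\<^sup>+z. (\<Prod>i\<in>UNIV. g i (z $ i)) \<partial>(lborel :: (real^'n) measure)) =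
      (\<integral>\<^sup>+z. (\<Prod>b\<in>Basis. g (inv ax b) (z \<bullet> b)) \<partial>lborel)"
    by (simp add: prod.reindex_bij_betw[OF bij, symmetric] inv) (simp add: ax_def inner_axis)
  also have "\<dots> = (\<Prod>b\<in>Basis. \<integral>\<^sup>+x. g (inv ax b) x \<partial>lborel)"
    by (rule nn_integral_lborel_prod) auto
  also have "\<dots> = (\<Prod>i\<in>UNIV. \<integral>\<^sup>+x. g i x \<partial>lborel)"
    by (simp add: prod.reindex_bij_betw[OF bij, symmetric] inv)
  finally show ?thesis .
qed

lemma sets_std_gaussian [simp, measurable_cong]: "sets std_gaussian = sets borel"
  and space_std_gaussian [simp]: "space std_gaussian = UNIV"
  by (simp_all add: std_gaussian_def)

lemma std_gaussian_eq:
  "std_gaussian = density lborel (\<lambda>z::real^'n. ennreal ((1 / sqrt (2 * pi)) ^ CARD('n) * exp (- (z \<bullet> z) / 2)))"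
proof -
  have "(\<Prod>i\<in>UNIV. std_normal_density (z $ i)) = (1 / sqrt (2 * pi)) ^ CARD('n) * exp (- (z \<bullet> z) / 2)"
    for z :: "real^'n"
  proof -
    have "- (z \<bullet> z) / 2 = (\<Sum>i\<in>UNIV. - (z $ i)\<^sup>2 / 2)"
      by (simp add: inner_vec_def power2_eq_square sum_negf sum_divide_distrib)
    then have "exp (- (z \<bullet> z) / 2) = (\<Prod>i\<in>UNIV. exp (- (z $ i)\<^sup>2 / 2))"
      by (simp only: exp_sum[OF finite])
    moreover have "(\<Prod>i\<in>(UNIV :: 'n set). 1 / sqrt (2 * pi)) = (1 / sqrt (2 * pi)) ^ CARD('n)"
      by (rule prod_constant)
    ultimately show ?thesis by (simp only: std_normal_density_def prod.distrib)
  qed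
  then show ?thesis by (simp add: std_gaussian_def)
qed

lemma nn_integral_std_normal_density: "(\<integral>\<^sup>+x. ennreal (std_normal_density x) \<partial>lborel) = 1"
  using prob_space.emeasure_space_1[OF prob_space_normal_density[of 1 0]]
  by (simp add: emeasure_density)

lemma prob_space_std_gaussian: "prob_space (std_gaussian :: (real^'n) measure)"
proof
  have "emeasure (std_gaussian :: (real^'n) measure) UNIV =
      (\<integral>\<^sup>+z. (\<Prod>i\<in>UNIV. ennreal (std_normal_density (z $ i))) \<partial>(lborel :: (real^'n) measure))"
    by (simp add: std_gaussian_def emeasure_density prod_ennreal)
  also have "\<dots> = 1"
    by (subst nn_integral_lborel_vec_prod) (simp_all add: nn_integral_std_normal_density)
  finally show "emeasure (std_gaussian :: (real^'n) measure) (space std_gaussian) = 1" by simp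
qed

text \<open>By the product form of the density, the other coordinates contribute factors 1 and
  coordinate \<open>k\<close> contributes the first absolute moment of the normal
  distribution.\<close>

lemma integrable_std_gaussian_component: "integrable (std_gaussian :: (real^'n) measure) (\<lambda>z. z $ k)"
proof (rule integrableI_bounded)
  have "(\<integral>\<^sup>+z. ennreal (norm (z $ k)) \<partial>(std_gaussian :: (real^'n) measure)) =
      (\<integral>\<^sup>+z. (\<Prod>i\<in>UNIV. ennreal (std_normal_density (z $ i)) * (if i = k then ennreal \<bar>z $ i\<bar> else 1)) \<partial>(lborel :: (real^'n) measure))"
    by (simp add: std_gaussian_def nn_integral_density prod_ennreal prod.distrib prod.delta)
  also have "\<dots> = (\<Prod>i\<in>UNIV. \<integral>\<^sup>+x. ennreal (std_normal_density x) * (if i = k then ennreal \<bar>x\<bar> else 1) \<partial>lborel)"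
    by (rule nn_integral_lborel_vec_prod) measurable
  also have "\<dots> < \<infinity>"
  proof -
    have "integrable lborel (\<lambda>x. std_normal_density x * \<bar>x\<bar>)"
      using integrable_std_normal_moment_abs[of 1] by simp
    then have "(\<integral>\<^sup>+x. ennreal (std_normal_density x * \<bar>x\<bar>) \<partial>lborel) < \<infinity>"
      by (simp add: integrable_iff_bounded abs_mult)
    then have "(\<integral>\<^sup>+x. ennreal (std_normal_density x) * (if i = k then ennreal \<bar>x\<bar> else 1) \<partial>lborel) \<noteq> \<top>" for i
      by (cases "i = k") (simp_all add: ennreal_mult' nn_integral_std_normal_density)
    then show ?thesis by (simp add: less_top[symmetric] ennreal_prod_eq_top)
  qed
  finally show "(\<integral>\<^sup>+z. ennreal (norm (z $ k)) \<partial>(std_gaussian :: (real^'n) measure)) < \<infinity>" .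
qed simp

text \<open>The density is even, so reflection at the origin turns the integral into its
  negative.\<close>

lemma integral_std_gaussian_component: "(\<integral>z. z $ k \<partial>(std_gaussian :: (real^'n) measure)) = 0"
proof -
  have eq: "distr std_gaussian borel uminus = (std_gaussian :: (real^'n) measure)"
    unfolding std_gaussian_eq
    by (subst (2) lborel_distr_uminus_euclidean[symmetric], subst density_distr) simp_all
  have "(\<integral>z. z $ k \<partial>(std_gaussian :: (real^'n) measure)) = (\<integral>z. z $ k \<partial>distr std_gaussian borel (uminus :: real^'n \<Rightarrow> _))"
    by (simp add: eq)
  also have "\<dots> = - (\<integral>z. z $ k \<partial>(std_gaussian :: (real^'n) measure))"
    by (subst integral_distr) simp_all
  finally show ?thesis by simp
qed

lemma integrable_vecI:
  fixes f :: "'a \<Rightarrow> real^'n"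
  assumes "\<And>i. integrable M (\<lambda>x. f x $ i)"
  shows "integrable M f"
proof -
  have "f = (\<lambda>x. \<Sum>i\<in>UNIV. (f x $ i) *\<^sub>R axis i 1)"
    by (simp add: fun_eq_iff vec_eq_iff axis_def if_distrib cong: if_cong)
  then show ?thesis
    by (subst \<open>f = _\<close>) (intro Bochner_Integration.integrable_sum integrable_scaleR_left assms)
qed

lemma std_gaussian_mean:
  "integrable (std_gaussian :: (real^'n) measure) (\<lambda>z. z)" "(\<integral>z. z \<partial>(std_gaussian :: (real^'n) measure)) = 0"
proof -
  show int: "integrable (std_gaussian :: (real^'n) measure) (\<lambda>z. z)"
    by (rule integrable_vecI) (rule integrable_std_gaussian_component)
  have "(\<integral>z. z \<partial>(std_gaussian :: (real^'n) measure)) $ k = 0" for k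
    using integral_bounded_linear[OF bounded_linear_vec_nth[of k] int] integral_std_gaussian_component[of k]
    by simp
  then show "(\<integral>z. z \<partial>(std_gaussian :: (real^'n) measure)) = 0" by (simp add: vec_eq_iff)
qed

lemma borel_measurable_matrix_vector [measurable]: "(\<lambda>x. (A :: real^'n^'m) *v x) \<in> borel_measurable borel"
  by (intro borel_measurable_continuous_onI linear_continuous_on matrix_vector_mul_bounded_linear)

lemma gaussian_law_mean:
  fixes N :: "(real^'n) measure"
  assumes "gaussian_law N a K"
  shows "prob_space N" "integrable N (\<lambda>z. z)" "(\<integral>z. z \<partial>N) = a"
proof -
  obtain A :: "real^'n^'n" where N: "N = distr std_gaussian borel (\<lambda>z. a + A *v z)"
    using assms by (auto simp: gaussian_law_def)
  interpret G: prob_space "std_gaussian :: (real^'n) measure" by (rule prob_space_std_gaussian)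
  show "prob_space N" unfolding N by (rule G.prob_space_distr) simp
  have int: "integrable std_gaussian (\<lambda>z. A *v z)" and "(\<integral>z. A *v z \<partial>std_gaussian) = 0"
    using integrable_bounded_linear[OF matrix_vector_mul_bounded_linear std_gaussian_mean(1)]
      integral_bounded_linear[OF matrix_vector_mul_bounded_linear std_gaussian_mean(1)]
    by (simp_all add: std_gaussian_mean)
  then show "integrable N (\<lambda>z. z)" "(\<integral>z. z \<partial>N) = a"
    unfolding N by (simp_all add: integrable_distr_eq integral_distr G.prob_space[simplified])
qed

text \<open>The hypothesis says that |z|^2 is the W-form at V z. The standard density is thus a
  function of the image point, while \<open>V\<close> changes Lebesgue measure only by a constant;
  that constant stays implicit in \<open>C\<close>.\<close>

lemma gaussian_image_density:
  fixes V W :: "real^'n^'n"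
  assumes V: "transpose V ** W ** V = mat 1"
  obtains C where "0 < C" "distr std_gaussian borel (\<lambda>z. a + V *v z) =
    density lborel (\<lambda>x. ennreal (C * exp (- ((x - a) \<bullet> (W *v (x - a))) / 2)))"
proof -
  have norm: "z \<bullet> z = (V *v z) \<bullet> (W *v (V *v z))" for z
  proof -
    have "z \<bullet> z = z \<bullet> ((transpose V ** W ** V) *v z)" by (simp add: V)
    then show ?thesis by (simp add: matrix_vector_mul_assoc[symmetric] inner_matrix_vector[of _ "transpose V"])
  qed
  have "inj ((*v) V)"
  proof (rule injI)
    fix x y assume "V *v x = V *v y"
    then show "x = y" by (metis V matrix_vector_mul_assoc matrix_vector_mul_lid)
  qed
  then obtain c where c: "0 < c" "c < \<infinity>" "distr lborel borel ((*v) V) = density lborel (\<lambda>_. c)"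
    using distr_lborel_linear[OF matrix_vector_mul_linear] by metis
  then obtain r where r: "c = ennreal r" "0 < r" by (cases c) auto
  have lb: "distr lborel borel (\<lambda>z. a + V *v z) = density lborel (\<lambda>_. c)"
  proof -
    have "distr lborel borel (\<lambda>z. a + V *v z) = distr (distr lborel borel ((*v) V)) borel ((+) a)"
      by (simp add: distr_distr o_def)
    also have "\<dots> = density (distr lborel borel ((+) a)) (\<lambda>_. c)"
      unfolding c(3) by (subst density_distr) simp_all
    finally show ?thesis by (simp add: lborel_distr_plus)
  qed
  define k where "k = (1 / sqrt (2 * pi)) ^ CARD('n)"
  have k: "0 < k" by (simp add: k_def)
  let ?g = "\<lambda>x. ennreal (k * exp (- ((x - a) \<bullet> (W *v (x - a))) / 2))"
  have "distr std_gaussian borel (\<lambda>z. a + V *v z) = density (distr lborel borel (\<lambda>z. a + V *v z)) ?g"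
    by (subst density_distr) (simp_all add: std_gaussian_eq norm[symmetric] k_def)
  also have "\<dots> = density lborel (\<lambda>x. c * ?g x)"
    unfolding lb by (subst density_density_eq) simp_all
  also have "\<dots> = density lborel (\<lambda>x. ennreal (r * k * exp (- ((x - a) \<bullet> (W *v (x - a))) / 2)))"
    using r k by (simp add: ennreal_mult'[symmetric] mult.assoc)
  finally show thesis using that[of "r * k"] r k by simp
qed

section \<open>Gaussians carried by an affine subspace\<close>

lemma sets_lborel_affine [simp, measurable_cong]: "sets (lborel_affine m S) = sets borel"
  and space_lborel_affine [simp]: "space (lborel_affine m S) = UNIV"
  by (simp_all add: lborel_affine_def Let_def)

lemma AE_lborel_affine:
  assumes "subspace S"
  shows "AE z in lborel_affine m S. z - m \<in> S"
proof -
  obtain B where B: "orthonormal_basis_of S B"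
    and aff: "lborel_affine m S = distr (\<Pi>\<^sub>M b\<in>B. lborel) borel (\<lambda>c. m + (\<Sum>b\<in>B. c b *\<^sub>R b))"
    using lborel_affine_basis[OF assms] by blast
  have [measurable]: "S \<in> sets borel" by (simp add: assms borel_closed closed_subspace)
  have "(\<Sum>b\<in>B. c b *\<^sub>R b) \<in> S" for c
    using B span_superset[of B] assms
    by (intro subspace_sum subspace_scale) (auto simp: orthonormal_basis_of_def)
  then show ?thesis unfolding aff by (subst AE_distr_iff) auto
qed

text \<open>The degenerate vector is the image of the nondegenerate a + V z under u \<mapsto> m + P
  u. Hypothesis \<open>W\<close> makes the density of the latter a product, and since
  \<open>a\<close> lies in \<open>S\<close> the centre affects only the factor that depends on P
  u.\<close>

lemma gaussian_affine_density:
  fixes V W :: "real^'n^'n"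
  assumes V: "transpose V ** W ** V = mat 1" and P: "orth_proj P S" and a: "a \<in> S"
    and W: "\<And>u. u \<bullet> (W *v u) = (P *v u) \<bullet> (W *v (P *v u)) + (u - P *v u) \<bullet> (u - P *v u)"
  obtains C where "0 < C" "distr std_gaussian borel (\<lambda>z. m + a + (P ** V) *v z) =
    density (lborel_affine m S) (\<lambda>z. ennreal (C * exp (- ((z - m - a) \<bullet> (W *v (z - m - a))) / 2)))"
proof -
  note PD = orth_projD[OF P]
  obtain c where c: "0 < c" "distr std_gaussian borel (\<lambda>z. a + V *v z) =
    density lborel (\<lambda>x. ennreal (c * exp (- ((x - a) \<bullet> (W *v (x - a))) / 2)))"
    by (rule gaussian_image_density[OF V])
  let ?e = "\<lambda>x. c * exp (- ((x - a) \<bullet> (W *v (x - a))) / 2)"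
  have split: "ennreal (?e u) = ennreal (?e (P *v u)) * ennreal (exp (- ((u - P *v u) \<bullet> (u - P *v u)) / 2))" for u
  proof -
    have "P *v (u - a) = P *v u - a" by (simp add: matrix_vector_mult_diff_distrib PD a)
    then have "(u - a) \<bullet> (W *v (u - a)) =
        (P *v u - a) \<bullet> (W *v (P *v u - a)) + (u - P *v u) \<bullet> (u - P *v u)"
      using W[of "u - a"] by simp
    then show ?thesis
      using c(1) by (simp add: ennreal_mult'[symmetric] exp_add[symmetric] add_divide_distrib mult.assoc)
  qed
  obtain k where k: "\<And>m g. g \<in> borel_measurable borel \<Longrightarrow>
    distr (density lborel (\<lambda>u. g (P *v u) * ennreal (exp (- ((u - P *v u) \<bullet> (u - P *v u)) / 2)))) borel (\<lambda>u. m + P *v u) =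
    density (lborel_affine m S) (\<lambda>z. k * g (z - m))"
    by (rule lborel_affine_split[where p="(*v) P" and S=S and h="\<lambda>v. ennreal (exp (- (v \<bullet> v) / 2))"])
      (use PD in auto)
  have "distr std_gaussian borel (\<lambda>z. m + a + (P ** V) *v z) =
      distr (distr std_gaussian borel (\<lambda>z. a + V *v z)) borel (\<lambda>u. m + P *v u)"
    using PD(5)[OF a]
    by (simp add: distr_distr o_def matrix_vector_mul_assoc[symmetric] matrix_vector_right_distrib add.assoc)
  also have "\<dots> = density (lborel_affine m S) (\<lambda>z. k * ennreal (?e (z - m)))"
    unfolding c(2) by (subst split, subst k[of "\<lambda>x. ennreal (?e x)"]) simp_all
  finally have eq: "distr std_gaussian borel (\<lambda>z. m + a + (P ** V) *v z) =
    density (lborel_affine m S) (\<lambda>z. k * ennreal (?e (z - m)))" .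
  \<comment> \<open>Total mass 1 rules out both k = 0 and k = \<infinity>, so \<open>k\<close> is a
    positive real.\<close>
  have "prob_space (density (lborel_affine m S) (\<lambda>z. k * ennreal (?e (z - m))))"
    unfolding eq[symmetric] by (rule prob_space.prob_space_distr[OF prob_space_std_gaussian]) simp
  then have "k * (\<integral>\<^sup>+z. ennreal (?e (z - m)) \<partial>lborel_affine m S) = 1"
    by (auto dest!: prob_space.emeasure_space_1 simp: emeasure_density nn_integral_cmult)
  then have "k \<noteq> 0" "k \<noteq> \<infinity>" by (auto simp: ennreal_top_mult split: if_splits)
  then obtain r where r: "k = ennreal r" "0 < r" by (cases k) (auto simp: less_le)
  show thesis
    by (rule that[of "r * c"]) (use eq r c(1) in \<open>simp_all add: ennreal_mult'[symmetric] mult.assoc\<close>)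
qed

section \<open>Conditional laws and Bayes' rule\<close>

text \<open>By independence (f, \<epsilon>) has a product law, and the map (z, e) \<mapsto> (z, h z
  + e) translates each fibre, which leaves Lebesgue measure unchanged. The law of \<open>f\<close>
  itself stays in the reference measure, so it may be singular.\<close>

lemma joint_law_additive_noise:
  fixes f :: "'a \<Rightarrow> 'b::second_countable_topology" and \<epsilon> :: "'a \<Rightarrow> 'c::euclidean_space"
  assumes "prob_space M"
    and [measurable]: "f \<in> borel_measurable M" "\<epsilon> \<in> borel_measurable M" "h \<in> borel_measurable borel"
      "\<phi> \<in> borel_measurable borel"
    and ind: "prob_space.indep_set M (sets (vimage_algebra (space M) f borel))
                               (sets (vimage_algebra (space M) \<epsilon> borel))"
    and \<epsilon>: "distr M borel \<epsilon> = density lborel \<phi>"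
  shows "distr M (borel \<Otimes>\<^sub>M borel) (\<lambda>\<omega>. (f \<omega>, h (f \<omega>) + \<epsilon> \<omega>)) =
    density (distr M borel f \<Otimes>\<^sub>M lborel) (\<lambda>(z, \<eta>). \<phi> (\<eta> - h z))"
proof -
  interpret prob_space M by fact
  let ?N = "distr M borel f" and ?E = "distr M borel \<epsilon>"
  interpret N: prob_space ?N by (rule prob_space_distr) simp
  interpret E: prob_space ?E by (rule prob_space_distr) simp
  have joint: "?N \<Otimes>\<^sub>M ?E = distr M (borel \<Otimes>\<^sub>M borel) (\<lambda>\<omega>. (f \<omega>, \<epsilon> \<omega>))"
  proof (rule pair_measure_eqI)
    show "sigma_finite_measure ?N" "sigma_finite_measure ?E" by unfold_locales
    show "sets (?N \<Otimes>\<^sub>M ?E) = sets (distr M (borel \<Otimes>\<^sub>M borel) (\<lambda>\<omega>. (f \<omega>, \<epsilon> \<omega>)))"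
      by (simp cong: sets_pair_measure_cong)
    fix A B assume "A \<in> sets ?N" "B \<in> sets ?E"
    then have [measurable]: "A \<in> sets borel" "B \<in> sets borel" by simp_all
    have "f -` A \<inter> space M \<in> sets (vimage_algebra (space M) f borel)"
      "\<epsilon> -` B \<inter> space M \<in> sets (vimage_algebra (space M) \<epsilon> borel)"
      by (auto intro: in_vimage_algebra)
    then have "prob ((f -` A \<inter> space M) \<inter> (\<epsilon> -` B \<inter> space M)) = prob (f -` A \<inter> space M) * prob (\<epsilon> -` B \<inter> space M)"
      by (rule indep_setD[OF ind])
    moreover have "(\<lambda>\<omega>. (f \<omega>, \<epsilon> \<omega>)) -` (A \<times> B) \<inter> space M = (f -` A \<inter> space M) \<inter> (\<epsilon> -` B \<inter> space M)"
      by auto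
    ultimately show "emeasure ?N A * emeasure ?E B =
        emeasure (distr M (borel \<Otimes>\<^sub>M borel) (\<lambda>\<omega>. (f \<omega>, \<epsilon> \<omega>))) (A \<times> B)"
      by (simp add: emeasure_distr emeasure_eq_measure ennreal_mult')
  qed
  show ?thesis
  proof (rule measure_eqI)
    show "sets (distr M (borel \<Otimes>\<^sub>M borel) (\<lambda>\<omega>. (f \<omega>, h (f \<omega>) + \<epsilon> \<omega>))) =
      sets (density (?N \<Otimes>\<^sub>M lborel) (\<lambda>(z, \<eta>). \<phi> (\<eta> - h z)))"
      by (simp cong: sets_pair_measure_cong)
    fix A assume "A \<in> sets (distr M (borel \<Otimes>\<^sub>M borel) (\<lambda>\<omega>. (f \<omega>, h (f \<omega>) + \<epsilon> \<omega>)))"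
    then have [measurable]: "A \<in> sets (borel \<Otimes>\<^sub>M borel)" by simp
    have "emeasure (distr M (borel \<Otimes>\<^sub>M borel) (\<lambda>\<omega>. (f \<omega>, h (f \<omega>) + \<epsilon> \<omega>))) A =
        (\<integral>\<^sup>+\<omega>. indicator A (f \<omega>, h (f \<omega>) + \<epsilon> \<omega>) \<partial>M)"
      by (subst nn_integral_indicator[symmetric], simp, subst nn_integral_distr) simp_all
    also have "\<dots> = (\<integral>\<^sup>+(z, e). indicator A (z, h z + e) \<partial>distr M (borel \<Otimes>\<^sub>M borel) (\<lambda>\<omega>. (f \<omega>, \<epsilon> \<omega>)))"
      by (subst nn_integral_distr) simp_all
    also have "\<dots> = (\<integral>\<^sup>+z. \<integral>\<^sup>+e. indicator A (z, h z + e) \<partial>?E \<partial>?N)"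
      unfolding joint[symmetric] by (subst E.nn_integral_fst[symmetric]) simp_all
    also have "\<dots> = (\<integral>\<^sup>+z. \<integral>\<^sup>+\<eta>. \<phi> (\<eta> - h z) * indicator A (z, \<eta>) \<partial>lborel \<partial>?N)"
    proof (rule nn_integral_cong)
      fix z :: 'b
      have "(\<integral>\<^sup>+e. indicator A (z, h z + e) \<partial>?E) = (\<integral>\<^sup>+e. \<phi> (h z + e - h z) * indicator A (z, h z + e) \<partial>lborel)"
        unfolding \<epsilon> by (simp add: nn_integral_density)
      also have "\<dots> = (\<integral>\<^sup>+\<eta>. \<phi> (\<eta> - h z) * indicator A (z, \<eta>) \<partial>distr lborel borel ((+) (h z)))"
        by (subst nn_integral_distr) simp_all
      finally show "(\<integral>\<^sup>+e. indicator A (z, h z + e) \<partial>?E) = (\<integral>\<^sup>+\<eta>. \<phi> (\<eta> - h z) * indicator A (z, \<eta>) \<partial>lborel)"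
        by (simp add: lborel_distr_plus)
    qed
    also have "\<dots> = emeasure (density (?N \<Otimes>\<^sub>M lborel) (\<lambda>(z, \<eta>). \<phi> (\<eta> - h z))) A"
      by (subst emeasure_density)
        (simp_all add: lborel.nn_integral_fst[symmetric] cong: sets_pair_measure_cong measurable_cong_sets)
    finally show "emeasure (distr M (borel \<Otimes>\<^sub>M borel) (\<lambda>\<omega>. (f \<omega>, h (f \<omega>) + \<epsilon> \<omega>))) A =
      emeasure (density (?N \<Otimes>\<^sub>M lborel) (\<lambda>(z, \<eta>). \<phi> (\<eta> - h z))) A" .
  qed
qed

text \<open>Countability allows null sets, one for each event, to be merged; stability under
  intersection makes agreement on \<open>E\<close> suffice for equality of measures. Finite
  intersections of basis sets have both properties, and the empty intersection supplies
  \<open>UNIV\<close>.\<close>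

lemma countable_Int_stable_generator_borel:
  obtains E :: "'b::second_countable_topology set set"
  where "countable E" "Int_stable E" "UNIV \<in> E" "sets borel = sigma_sets UNIV E"
proof -
  obtain B :: "'b set set" where B: "countable B" "topological_basis B"
    using ex_countable_basis by blast
  define E where "E = Inter ` {F. finite F \<and> F \<subseteq> B}"
  have "countable E" unfolding E_def
    by (intro countable_image countable_Collect_finite_subset B)
  moreover have "Int_stable E"
  proof (rule Int_stableI)
    fix a b assume "a \<in> E" "b \<in> E"
    then obtain F G where "finite F" "F \<subseteq> B" "a = \<Inter>F" "finite G" "G \<subseteq> B" "b = \<Inter>G"
      by (auto simp: E_def)
    then have "a \<inter> b = \<Inter>(F \<union> G)" "finite (F \<union> G)" "F \<union> G \<subseteq> B" by auto
    then show "a \<inter> b \<in> E" unfolding E_def by blast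
  qed
  moreover have "UNIV \<in> E" unfolding E_def by (rule image_eqI[of _ _ "{}"]) auto
  moreover have "sets borel = sigma_sets UNIV E"
  proof
    have "B \<subseteq> E" unfolding E_def by (auto intro!: image_eqI[of _ _ "{_}"])
    then show "sets borel \<subseteq> sigma_sets UNIV E"
      unfolding borel_eq_countable_basis[OF B] by (simp add: sigma_sets_mono')
    have "E \<subseteq> sets borel"
      using topological_basis_open[OF B(2)] by (auto simp: E_def intro!: borel_open open_Inter)
    then show "sigma_sets UNIV E \<subseteq> sets borel"
      using sets.sigma_sets_subset[of E borel] by simp
  qed
  ultimately show thesis by (rule that)
qed

lemma regular_cond_lawD:
  assumes "regular_cond_law M X Y \<kappa>"
  shows "prob_space (\<kappa> \<eta>)" "sets (\<kappa> \<eta>) = sets borel"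
    "A \<in> sets borel \<Longrightarrow> (\<lambda>\<eta>. emeasure (\<kappa> \<eta>) A) \<in> borel_measurable borel"
proof -
  have \<kappa>: "\<kappa> \<in> borel \<rightarrow>\<^sub>M prob_algebra borel" using assms by (simp add: regular_cond_law_def)
  then have "\<kappa> \<eta> \<in> space (prob_algebra borel)" by (rule measurable_space) simp
  then show "prob_space (\<kappa> \<eta>)" "sets (\<kappa> \<eta>) = sets borel" by (simp_all add: space_prob_algebra)
  show "(\<lambda>\<eta>. emeasure (\<kappa> \<eta>) A) \<in> borel_measurable borel" if "A \<in> sets borel"
    using measurable_compose[OF measurable_prob_algebraD[OF \<kappa>] measurable_emeasure_subprob_algebra[OF that]] .
qed

text \<open>For a fixed event both kernels, as functions of \<eta>, are densities of the same
  measure relative to the law of \<open>Y\<close>, hence almost surely equal. A countable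
  intersection-stable generator removes the dependence of the null set on the event.\<close>

lemma regular_cond_law_unique:
  fixes X :: "'a \<Rightarrow> 'b::second_countable_topology" and Y :: "'a \<Rightarrow> 'c::topological_space"
  assumes "prob_space M" and [measurable]: "Y \<in> borel_measurable M"
    and \<kappa>: "regular_cond_law M X Y \<kappa>" and \<kappa>': "regular_cond_law M X Y \<kappa>'"
  shows "AE \<eta> in distr M borel Y. \<kappa> \<eta> = \<kappa>' \<eta>"
proof -
  interpret prob_space M by fact
  interpret Y: prob_space "distr M borel Y" by (rule prob_space_distr) simp
  obtain E :: "'b set set" where E: "countable E" "Int_stable E" "UNIV \<in> E" "sets borel = sigma_sets UNIV E"
    by (rule countable_Int_stable_generator_borel)
  have "AE \<eta> in distr M borel Y. emeasure (\<kappa> \<eta>) A = emeasure (\<kappa>' \<eta>) A" if "A \<in> E" for A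
  proof (rule Y.density_unique)
    have A: "A \<in> sets borel" using that E(4) by auto
    note [measurable] = regular_cond_lawD(3)[OF \<kappa> A] regular_cond_lawD(3)[OF \<kappa>' A]
    show "(\<lambda>\<eta>. emeasure (\<kappa> \<eta>) A) \<in> borel_measurable (distr M borel Y)"
      "(\<lambda>\<eta>. emeasure (\<kappa>' \<eta>) A) \<in> borel_measurable (distr M borel Y)" by simp_all
    show "density (distr M borel Y) (\<lambda>\<eta>. emeasure (\<kappa> \<eta>) A) = density (distr M borel Y) (\<lambda>\<eta>. emeasure (\<kappa>' \<eta>) A)"
      using \<kappa> \<kappa>' A by (intro measure_eqI) (auto simp: emeasure_density regular_cond_law_def)
  qed
  then have "AE \<eta> in distr M borel Y. \<forall>A\<in>E. emeasure (\<kappa> \<eta>) A = emeasure (\<kappa>' \<eta>) A"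
    using E(1) by (simp add: AE_ball_countable)
  then show ?thesis
  proof (rule AE_mp, intro AE_I2 impI)
    fix \<eta> assume eq: "\<forall>A\<in>E. emeasure (\<kappa> \<eta>) A = emeasure (\<kappa>' \<eta>) A"
    interpret K: prob_space "\<kappa> \<eta>" by (rule regular_cond_lawD[OF \<kappa>])
    show "\<kappa> \<eta> = \<kappa>' \<eta>"
      by (rule measure_eqI_generator_eq[OF E(2), of UNIV _ _ "\<lambda>_. UNIV"])
        (use eq E in \<open>auto simp: regular_cond_lawD[OF \<kappa>] regular_cond_lawD[OF \<kappa>']\<close>)
  qed
qed

text \<open>Positivity and the uniform bound \<open>b\<close> make the evidence positive and finite
  at every \<eta>, so the posterior is a probability measure for each \<eta> and not merely for
  almost all of them.\<close>

locale bayes_density = prob_space M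
  for M :: "'a measure" +
  fixes f :: "'a \<Rightarrow> 'b::second_countable_topology" and y :: "'a \<Rightarrow> 'c::euclidean_space"
    and lik :: "'b \<Rightarrow> 'c \<Rightarrow> real" and b :: real
  assumes f [measurable]: "f \<in> borel_measurable M" and y [measurable]: "y \<in> borel_measurable M"
    and lik [measurable]: "(\<lambda>(z, \<eta>). lik z \<eta>) \<in> borel_measurable (borel \<Otimes>\<^sub>M borel)"
    and lik_pos: "0 < lik z \<eta>" and lik_le: "lik z \<eta> \<le> b"
    and joint: "distr M (borel \<Otimes>\<^sub>M borel) (\<lambda>\<omega>. (f \<omega>, y \<omega>)) =
      density (distr M borel f \<Otimes>\<^sub>M lborel) (\<lambda>(z, \<eta>). ennreal (lik z \<eta>))"
begin

abbreviation "prior \<equiv> distr M borel f"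

definition "evidence \<eta> = (\<integral>z. lik z \<eta> \<partial>prior)"

definition "posterior \<eta> = density prior (\<lambda>z. ennreal (lik z \<eta> / evidence \<eta>))"

sublocale N: prob_space prior by (rule prob_space_distr) simp

sublocale NL: pair_sigma_finite prior lborel ..

lemma lik_measurable1 [measurable]: "(\<lambda>z. lik z \<eta>) \<in> borel_measurable borel"
  using measurable_compose[OF measurable_Pair2'[of \<eta> borel borel] lik] by simp

lemma integrable_lik: "integrable prior (\<lambda>z. lik z \<eta>)"
  by (rule N.integrable_const_bound[of _ b]) (auto intro!: AE_I2 simp: lik_le less_imp_le[OF lik_pos])

lemma evidence_pos: "0 < evidence \<eta>"
  unfolding evidence_def by (rule N.expectation_greater[OF integrable_lik]) (simp add: lik_pos)

lemma nn_integral_lik: "(\<integral>\<^sup>+z. ennreal (lik z \<eta>) \<partial>prior) = ennreal (evidence \<eta>)"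
  unfolding evidence_def by (rule nn_integral_eq_integral[OF integrable_lik]) (simp add: less_imp_le[OF lik_pos])

lemma evidence_measurable [measurable]: "evidence \<in> borel_measurable borel"
  unfolding evidence_def[abs_def] by (rule N.borel_measurable_lebesgue_integral) simp

lemma sets_posterior [simp]: "sets (posterior \<eta>) = sets borel"
  by (simp add: posterior_def)

lemma emeasure_posterior:
  assumes [measurable]: "A \<in> sets borel"
  shows "emeasure (posterior \<eta>) A * ennreal (evidence \<eta>) = (\<integral>\<^sup>+z. ennreal (lik z \<eta>) * indicator A z \<partial>prior)"
proof -
  have "emeasure (posterior \<eta>) A * ennreal (evidence \<eta>) =
      (\<integral>\<^sup>+z. ennreal (lik z \<eta> / evidence \<eta>) * indicator A z * ennreal (evidence \<eta>) \<partial>prior)"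
    by (simp add: posterior_def emeasure_density nn_integral_multc)
  also have "\<dots> = (\<integral>\<^sup>+z. ennreal (lik z \<eta>) * indicator A z \<partial>prior)"
  proof (rule nn_integral_cong)
    fix z
    have "ennreal (lik z \<eta> / evidence \<eta>) * ennreal (evidence \<eta>) = ennreal (lik z \<eta>)"
      using evidence_pos[of \<eta>] lik_pos[of z \<eta>] by (simp add: ennreal_mult'[symmetric])
    then show "ennreal (lik z \<eta> / evidence \<eta>) * indicator A z * ennreal (evidence \<eta>) =
        ennreal (lik z \<eta>) * indicator A z"
      by (metis mult.assoc mult.commute)
  qed
  finally show ?thesis .
qed

lemma prob_space_posterior: "prob_space (posterior \<eta>)"
proof
  have "emeasure (posterior \<eta>) UNIV * ennreal (evidence \<eta>) = ennreal (evidence \<eta>)"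
    by (simp add: emeasure_posterior nn_integral_lik)
  then have "emeasure (posterior \<eta>) UNIV = 1"
    using ennreal_mult_cancel_left[of "ennreal (evidence \<eta>)" "emeasure (posterior \<eta>) UNIV" 1] evidence_pos[of \<eta>]
    by (simp add: mult.commute)
  then show "emeasure (posterior \<eta>) (space (posterior \<eta>)) = 1"
    by (simp add: posterior_def)
qed

lemma emeasure_joint:
  assumes [measurable]: "A \<in> sets borel" "B \<in> sets borel"
  shows "emeasure M {\<omega> \<in> space M. f \<omega> \<in> A \<and> y \<omega> \<in> B} =
    (\<integral>\<^sup>+\<eta>. emeasure (posterior \<eta>) A * ennreal (evidence \<eta>) * indicator B \<eta> \<partial>lborel)"
proof -
  have "{\<omega> \<in> space M. f \<omega> \<in> A \<and> y \<omega> \<in> B} = (\<lambda>\<omega>. (f \<omega>, y \<omega>)) -` (A \<times> B) \<inter> space M" by auto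
  then have "emeasure M {\<omega> \<in> space M. f \<omega> \<in> A \<and> y \<omega> \<in> B} =
      emeasure (distr M (borel \<Otimes>\<^sub>M borel) (\<lambda>\<omega>. (f \<omega>, y \<omega>))) (A \<times> B)"
    by (simp add: emeasure_distr)
  also have "\<dots> = (\<integral>\<^sup>+(z, \<eta>). ennreal (lik z \<eta>) * indicator A z * indicator B \<eta> \<partial>(prior \<Otimes>\<^sub>M lborel))"
    unfolding joint by (subst emeasure_density)
      (auto simp: indicator_times mult.assoc cong: sets_pair_measure_cong measurable_cong_sets intro!: nn_integral_cong)
  also have "\<dots> = (\<integral>\<^sup>+\<eta>. \<integral>\<^sup>+z. ennreal (lik z \<eta>) * indicator A z * indicator B \<eta> \<partial>prior \<partial>lborel)"
    by (subst NL.nn_integral_snd[symmetric]) simp_all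
  also have "\<dots> = (\<integral>\<^sup>+\<eta>. emeasure (posterior \<eta>) A * ennreal (evidence \<eta>) * indicator B \<eta> \<partial>lborel)"
    by (simp add: emeasure_posterior nn_integral_multc)
  finally show ?thesis .
qed

text \<open>Taking the whole space for \<open>A\<close> in \<open>emeasure_joint\<close> leaves only
  the evidence, because every posterior has mass 1.\<close>

lemma distr_y: "distr M borel y = density lborel (\<lambda>\<eta>. ennreal (evidence \<eta>))"
proof (rule measure_eqI)
  fix B assume "B \<in> sets (distr M borel y)"
  then have [measurable]: "B \<in> sets borel" by simp
  have "emeasure (posterior \<eta>) UNIV = 1" for \<eta>
    using prob_space.emeasure_space_1[OF prob_space_posterior[of \<eta>]] by (simp add: posterior_def)
  then show "emeasure (distr M borel y) B = emeasure (density lborel (\<lambda>\<eta>. ennreal (evidence \<eta>))) B"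
    using emeasure_joint[of UNIV B] by (simp add: emeasure_distr emeasure_density vimage_def Int_def conj_commute)
qed simp

lemma posterior_measurable [measurable]: "posterior \<in> borel \<rightarrow>\<^sub>M prob_algebra borel"
proof (intro measurable_prob_algebraI measurable_subprob_algebra)
  show "prob_space (posterior \<eta>)" for \<eta> by (rule prob_space_posterior)
  show "subprob_space (posterior \<eta>)" for \<eta>
    by (rule prob_space_imp_subprob_space[OF prob_space_posterior])
  fix A :: "'b set" assume [measurable]: "A \<in> sets borel"
  show "(\<lambda>\<eta>. emeasure (posterior \<eta>) A) \<in> borel_measurable borel"
    unfolding posterior_def by (subst emeasure_density) simp_all
qed simp

text \<open>By \<open>distr_y\<close> the evidence is exactly the factor between integrals against
  the law of \<open>y\<close> and integrals against Lebesgue measure.\<close>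

lemma regular_cond_law_posterior: "regular_cond_law M f y posterior"
  unfolding regular_cond_law_def
proof (intro conjI ballI)
  fix A :: "'b set" and B :: "'c set"
  assume A[measurable]: "A \<in> sets borel" and B[measurable]: "B \<in> sets borel"
  have [measurable]: "(\<lambda>\<eta>. emeasure (posterior \<eta>) A) \<in> borel_measurable borel"
    using measurable_compose[OF measurable_prob_algebraD[OF posterior_measurable] measurable_emeasure_subprob_algebra[OF A]] .
  show "emeasure M {\<omega> \<in> space M. f \<omega> \<in> A \<and> y \<omega> \<in> B} =
      (\<integral>\<^sup>+\<eta>. emeasure (posterior \<eta>) A * indicator B \<eta> \<partial>distr M borel y)"
    unfolding distr_y emeasure_joint[OF A B]
    by (subst nn_integral_density) (auto intro!: nn_integral_cong simp: mult_ac)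
qed (rule posterior_measurable)

lemma integral_posterior:
  fixes g :: "'b \<Rightarrow> real"
  assumes [measurable]: "g \<in> borel_measurable borel"
  shows "evidence \<eta> * (\<integral>z. g z \<partial>posterior \<eta>) = (\<integral>z. lik z \<eta> * g z \<partial>prior)"
  unfolding posterior_def using evidence_pos[of \<eta>] lik_pos
  by (subst integral_real_density) (auto simp: less_imp_le)

text \<open>This ties the kernel to conditional expectation given the sigma-algebra generated by
  \<open>y\<close>. Its events are preimages of Borel sets, and on each of them Fubini yields the
  required equality of integrals.\<close>

lemma real_cond_exp_posterior:
  fixes g :: "'b \<Rightarrow> real"
  assumes g[measurable]: "g \<in> borel_measurable borel" and int: "integrable M (\<lambda>\<omega>. g (f \<omega>))"
  shows "AE \<omega> in M. real_cond_exp M (vimage_algebra (space M) y borel) (\<lambda>\<omega>. g (f \<omega>)) \<omega> =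
    (\<integral>z. g z \<partial>posterior (y \<omega>))"
proof -
  let ?F = "vimage_algebra (space M) y borel"
  define G where "G \<eta> = (\<integral>z. g z \<partial>posterior \<eta>)" for \<eta>
  \<comment> \<open>As a quotient of two parameter integrals \<open>G\<close> is measurable.\<close>
  have G_eq: "G \<eta> = (\<integral>z. lik z \<eta> * g z \<partial>prior) / evidence \<eta>" for \<eta>
    using integral_posterior[OF g, of \<eta>] evidence_pos[of \<eta>] by (simp add: G_def field_simps)
  have [measurable]: "(\<lambda>\<eta>. \<integral>z. lik z \<eta> * g z \<partial>prior) \<in> borel_measurable borel"
    by (rule N.borel_measurable_lebesgue_integral) simp
  have G[measurable]: "G \<in> borel_measurable borel" unfolding G_eq[abs_def] by simp
  have sets_F: "sets ?F = {y -` B \<inter> space M | B. B \<in> sets borel}"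
    by (rule sets_vimage_algebra2) simp
  have sub: "subalgebra M ?F"
    using measurable_sets[OF y] by (auto simp: subalgebra_def sets_F)
  interpret F: finite_measure_subalgebra M ?F
    by unfold_locales (rule sub)
  have main: "integrable lborel (\<lambda>\<eta>. evidence \<eta> * G \<eta> * indicator B \<eta>)"
    "(\<integral>\<omega>. g (f \<omega>) * indicator B (y \<omega>) \<partial>M) = (\<integral>\<eta>. evidence \<eta> * G \<eta> * indicator B \<eta> \<partial>lborel)"
    if [measurable]: "B \<in> sets borel" for B
  proof -
    \<comment> \<open>\<open>?k\<close> is \<open>?h\<close> times the likelihood: integrating
      \<open>?h\<close> against the joint law means integrating \<open>?k\<close> against prior
      times Lebesgue measure, where Fubini applies.\<close>
    let ?h = "\<lambda>(z, \<eta>). g z * indicator B \<eta>" and ?k = "\<lambda>(z, \<eta>). lik z \<eta> * (g z * indicator B \<eta>)"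
    have "integrable M (\<lambda>\<omega>. g (f \<omega>) * indicator B (y \<omega>))"
      by (rule Bochner_Integration.integrable_bound[OF int]) (auto simp: indicator_def)
    then have "integrable (distr M (borel \<Otimes>\<^sub>M borel) (\<lambda>\<omega>. (f \<omega>, y \<omega>))) ?h"
      by (subst integrable_distr_eq) simp_all
    then have k: "integrable (prior \<Otimes>\<^sub>M lborel) ?k"
      unfolding joint split_beta' by (subst (asm) integrable_density)
        (auto simp: less_imp_le[OF lik_pos] cong: sets_pair_measure_cong measurable_cong_sets)
    have inner: "(\<integral>z. lik z \<eta> * (g z * indicator B \<eta>) \<partial>prior) = evidence \<eta> * G \<eta> * indicator B \<eta>" for \<eta>
      using integral_posterior[OF g, of \<eta>] by (simp add: G_def mult.assoc[symmetric])
    show "integrable lborel (\<lambda>\<eta>. evidence \<eta> * G \<eta> * indicator B \<eta>)"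
      using NL.integrable_snd[OF k] by (simp add: inner)
    have "(\<integral>\<omega>. g (f \<omega>) * indicator B (y \<omega>) \<partial>M) =
        (\<integral>p. ?h p \<partial>distr M (borel \<Otimes>\<^sub>M borel) (\<lambda>\<omega>. (f \<omega>, y \<omega>)))"
      by (subst integral_distr) simp_all
    also have "\<dots> = (\<integral>p. ?k p \<partial>(prior \<Otimes>\<^sub>M lborel))"
      unfolding joint split_beta' by (subst integral_density)
        (auto simp: less_imp_le[OF lik_pos] cong: sets_pair_measure_cong measurable_cong_sets)
    also have "\<dots> = (\<integral>\<eta>. evidence \<eta> * G \<eta> * indicator B \<eta> \<partial>lborel)"
      using NL.integral_snd[OF k] by (simp add: inner)
    finally show "(\<integral>\<omega>. g (f \<omega>) * indicator B (y \<omega>) \<partial>M) = (\<integral>\<eta>. evidence \<eta> * G \<eta> * indicator B \<eta> \<partial>lborel)" .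
  qed
  have "AE \<omega> in M. real_cond_exp M ?F (\<lambda>\<omega>. g (f \<omega>)) \<omega> = G (y \<omega>)"
  proof (rule F.real_cond_exp_charact[OF _ int])
    have "integrable (distr M borel y) G"
      unfolding distr_y by (subst integrable_density)
        (use main(1)[of UNIV] in \<open>auto simp: less_imp_le[OF evidence_pos]\<close>)
    then show "integrable M (\<lambda>\<omega>. G (y \<omega>))"
      by (subst (asm) integrable_distr_eq) simp_all
    show "(\<lambda>\<omega>. G (y \<omega>)) \<in> borel_measurable ?F"
      by (rule measurable_compose[OF measurable_vimage_algebra1 G]) simp
    fix A assume "A \<in> sets ?F"
    then obtain B where B[measurable]: "B \<in> sets borel" and A: "A = y -` B \<inter> space M"
      by (auto simp: sets_F)
    have "(\<integral>\<omega>\<in>A. g (f \<omega>) \<partial>M) = (\<integral>\<omega>. g (f \<omega>) * indicator B (y \<omega>) \<partial>M)"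
      unfolding set_lebesgue_integral_def A by (rule Bochner_Integration.integral_cong) (auto simp: indicator_def)
    also have "\<dots> = (\<integral>\<eta>. G \<eta> * indicator B \<eta> \<partial>distr M borel y)"
      unfolding distr_y by (subst integral_density) (auto simp: less_imp_le[OF evidence_pos] main mult.assoc)
    also have "\<dots> = (\<integral>\<omega>. G (y \<omega>) * indicator B (y \<omega>) \<partial>M)"
      by (subst integral_distr) simp_all
    also have "\<dots> = (\<integral>\<omega>\<in>A. G (y \<omega>) \<partial>M)"
      unfolding set_lebesgue_integral_def A by (rule Bochner_Integration.integral_cong) (auto simp: indicator_def)
    finally show "(\<integral>\<omega>\<in>A. g (f \<omega>) \<partial>M) = (\<integral>\<omega>\<in>A. G (y \<omega>) \<partial>M)" .
  qed
  then show ?thesis by (simp add: G_def)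
qed

end

section \<open>The linear Gaussian model\<close>

text \<open>The compressed matrix has no block linking \<open>S\<close> to its complement. This
  supplies the splitting hypothesis of \<open>gaussian_affine_density\<close>.\<close>

lemma compressed_form_split:
  fixes Q :: "real^'n^'n"
  assumes P: "orth_proj P S"
  defines "W \<equiv> P ** Q ** P + (mat 1 - P)"
  shows "u \<bullet> (W *v u) = (P *v u) \<bullet> (W *v (P *v u)) + (u - P *v u) \<bullet> (u - P *v u)"
proof -
  note PD = orth_projD[OF P]
  have "(P *v u) \<bullet> (W *v (P *v u)) = (P *v u) \<bullet> (Q *v (P *v u))"
    unfolding W_def compressed_form_eq[OF P PD(4)] inner_matrix_vector[of _ P] PD ..
  moreover have "u \<bullet> ((P ** Q ** P) *v u) = (P *v u) \<bullet> (Q *v (P *v u))"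
    by (simp add: matrix_vector_mul_assoc[symmetric] inner_matrix_vector[of _ P] PD)
  moreover have "u \<bullet> (u - P *v u) = (u - P *v u) \<bullet> (u - P *v u)"
    using PD(6)[OF PD(4), of u u] by (simp add: inner_diff_left inner_diff_right inner_commute)
  ultimately show ?thesis
    by (simp add: W_def matrix_vector_mult_add_rdistrib matrix_vector_mult_diff_rdistrib inner_add_right)
qed

lemma compressed_form_inner:
  fixes Q :: "real^'n^'n"
  assumes P: "orth_proj P S" and x: "x \<in> S"
  shows "x \<bullet> ((P ** Q ** P + (mat 1 - P)) *v x) = x \<bullet> (Q *v x)"
  unfolding compressed_form_eq[OF assms] inner_matrix_vector[of _ P] orth_projD(1,5)[OF P] orth_projD(5)[OF assms] ..

text \<open>\<open>A\<close> stands for whichever factor of \<open>K\<close> witnesses the Gaussian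
  law of the prior. Nothing probabilistic is assumed: up to the densities, this is linear algebra
  for a fixed observation \<eta>.\<close>

locale map_estimation =
  fixes m :: "real^'n" and K A P :: "real^'n^'n" and H :: "real^'n^'p" and R :: "real^'p^'p"
  assumes K: "K = A ** transpose A" and R: "pos_def R" and P: "orth_proj P (range ((*v) K))"
begin

abbreviation "S \<equiv> range ((*v) K)"
abbreviation "Ri \<equiv> matrix_inv R"
definition "Q = pinv K + transpose H ** Ri ** H"
definition "d \<eta> = \<eta> - H *v m"
definition "b \<eta> = (transpose H ** Ri) *v d \<eta>"
definition "J \<eta> x = 1/2 * (x \<bullet> (Q *v x)) + - b \<eta> \<bullet> x + 1/2 * (d \<eta> \<bullet> (Ri *v d \<eta>))"
definition "W = P ** Q ** P + (mat 1 - P)"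
definition "sol \<eta> = matrix_inv W *v (P *v b \<eta>)"

lemmas PD = orth_projD[OF P]
lemmas X = pinv_psd[OF K P]

lemma Ri: "pos_def Ri" by (rule pos_def_matrix_inv[OF R])

lemma Ri_sym: "transpose Ri = Ri" and Ri_nonneg: "0 \<le> x \<bullet> (Ri *v x)"
  using Ri by (auto simp: pos_def_def) (metis inner_zero_left less_imp_le order_refl)

lemma Q_sym: "transpose Q = Q"
  by (simp add: Q_def transpose_add matrix_transpose_mul matrix_mul_assoc X Ri_sym)

lemma Q_form: "x \<bullet> (Q *v x) = x \<bullet> (pinv K *v x) + (H *v x) \<bullet> (Ri *v (H *v x))"
  by (simp add: Q_def matrix_vector_mult_add_rdistrib inner_add_right matrix_vector_mul_assoc[symmetric]
      inner_matrix_vector[of x "transpose H"])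

lemma Q_nonneg: "0 \<le> x \<bullet> (Q *v x)"
  unfolding Q_form by (intro add_nonneg_nonneg pinv_psd_pos(1)[OF K P] Ri_nonneg)

text \<open>Strictness comes from the prior term, whatever the rank of \<open>H\<close>; the data
  term only has to be nonnegative.\<close>

lemma Q_pos: "x \<in> S \<Longrightarrow> x \<noteq> 0 \<Longrightarrow> 0 < x \<bullet> (Q *v x)"
  unfolding Q_form by (intro add_pos_nonneg pinv_psd_pos(2)[OF K P] Ri_nonneg)

lemma W: "pos_def W"
  unfolding W_def by (rule compressed_form_pos_def[OF P Q_sym Q_pos])

lemma sol: "sol \<eta> \<in> S" "P *v (Q *v sol \<eta>) = P *v b \<eta>"
  using compressed_form_solution[OF P pos_def_invertible[OF W[unfolded W_def]]]
  by (simp_all add: sol_def W_def)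

lemma J_square: "x \<in> S \<Longrightarrow> J \<eta> x = J \<eta> (sol \<eta>) + 1/2 * ((x - sol \<eta>) \<bullet> (Q *v (x - sol \<eta>)))"
  using complete_square[OF P Q_sym _ sol] by (simp add: J_def)

section \<open>The minimiser and its normal equations\<close>

lemma is_arg_min_J_iff: "is_arg_min (J \<eta>) (\<lambda>x. x \<in> S) x \<longleftrightarrow> x = sol \<eta>"
proof
  assume *: "is_arg_min (J \<eta>) (\<lambda>x. x \<in> S) x"
  show "x = sol \<eta>"
  proof (rule ccontr)
    assume "x \<noteq> sol \<eta>"
    moreover have "x \<in> S" using * by (simp add: is_arg_min_def)
    ultimately have "J \<eta> (sol \<eta>) < J \<eta> x"
      using Q_pos[of "x - sol \<eta>"] J_square[of x \<eta>] subspace_diff[OF PD(7) _ sol(1)] by simp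
    then show False using * sol(1)[of \<eta>] unfolding is_arg_min_def by blast
  qed
next
  assume "x = sol \<eta>"
  moreover have "\<not> J \<eta> x < J \<eta> (sol \<eta>)" if "x \<in> S" for x
    using J_square[OF that, of \<eta>] Q_nonneg[of "x - sol \<eta>"] by simp
  ultimately show "is_arg_min (J \<eta>) (\<lambda>x. x \<in> S) x"
    using sol(1) by (auto simp: is_arg_min_def)
qed

lemma normal_equation_weak: "v \<in> S \<Longrightarrow> v \<bullet> (Q *v sol \<eta>) = v \<bullet> b \<eta>"
  using sol(2)[of \<eta>] PD(1,5) by (metis inner_matrix_vector)

text \<open>If H^T maps into \<open>S\<close>, both sides lie in \<open>S\<close>, so applying
  \<open>P\<close> to the equation loses nothing.\<close>

lemma normal_equation:
  assumes "range ((*v) (transpose H)) \<subseteq> S"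
  shows "Q *v sol \<eta> = b \<eta>"
proof -
  have HS: "transpose H *v w \<in> S" for w using assms by blast
  have "pinv K *v sol \<eta> \<in> S" using PD(4) X(3) by (metis matrix_vector_mul_assoc)
  then have "Q *v sol \<eta> \<in> S"
    using HS by (simp add: Q_def matrix_vector_mult_add_rdistrib matrix_vector_mul_assoc[symmetric] subspace_add PD)
  moreover have "b \<eta> \<in> S" using HS by (simp add: b_def matrix_vector_mul_assoc[symmetric])
  ultimately show ?thesis using sol(2) PD(5) by metis
qed

lemma J_misfit: "J \<eta> x = 1/2 * ((d \<eta> - H *v x) \<bullet> (Ri *v (d \<eta> - H *v x))) + 1/2 * (x \<bullet> (pinv K *v x))"
proof -
  have "b \<eta> \<bullet> x = d \<eta> \<bullet> (Ri *v (H *v x))"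
    using Ri_sym
    by (metis b_def inner_commute inner_matrix_vector matrix_vector_mul_assoc transpose_transpose)
  moreover have "(H *v x) \<bullet> (Ri *v d \<eta>) = d \<eta> \<bullet> (Ri *v (H *v x))"
    by (metis Ri_sym inner_commute inner_matrix_vector)
  ultimately show ?thesis
    by (simp add: J_def Q_form matrix_vector_mult_diff_distrib inner_diff_left inner_diff_right field_simps)
qed

text \<open>The convexity gap is t (1 - t) / 2 times the Q-form at x - y. \<open>Q\<close> is
  semidefinite on the whole space, so convexity is not confined to \<open>S\<close>.\<close>

lemma convex_J: "convex_on UNIV (J \<eta>)"
proof (rule convex_onI)
  fix t :: real and x y assume t: "0 < t" "t < 1"
  have sym: "y \<bullet> (Q *v x) = x \<bullet> (Q *v y)" by (metis Q_sym inner_commute inner_matrix_vector)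
  let ?a = "x \<bullet> (Q *v x)" and ?b = "x \<bullet> (Q *v y)" and ?c = "y \<bullet> (Q *v y)"
  have "J \<eta> ((1 - t) *\<^sub>R x + t *\<^sub>R y) = 1/2 * ((1 - t) * (1 - t) * ?a + 2 * t * (1 - t) * ?b + t * t * ?c)
      + ((1 - t) * (- b \<eta> \<bullet> x) + t * (- b \<eta> \<bullet> y)) + 1/2 * (d \<eta> \<bullet> (Ri *v d \<eta>))"
    unfolding J_def matrix_vector_right_distrib matrix_vector_mult_scaleR inner_add_left inner_add_right
      inner_scaleR_left inner_scaleR_right sym by algebra
  then have "(1 - t) * J \<eta> x + t * J \<eta> y - J \<eta> ((1 - t) *\<^sub>R x + t *\<^sub>R y) = 1/2 * (t * (1 - t) * (?a - 2 * ?b + ?c))"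
    unfolding J_def by algebra
  moreover have "0 \<le> t * (1 - t) * ((x - y) \<bullet> (Q *v (x - y)))"
    using t Q_nonneg by (intro mult_nonneg_nonneg) auto
  moreover have "(x - y) \<bullet> (Q *v (x - y)) = ?a - 2 * ?b + ?c"
    by (simp add: matrix_vector_mult_diff_distrib inner_diff_left inner_diff_right sym)
  ultimately show "J \<eta> ((1 - t) *\<^sub>R x + t *\<^sub>R y) \<le> (1 - t) * J \<eta> x + t * J \<eta> y"
    by simp
qed simp

lemma pos_def_K:
  assumes "pos_def K"
  shows "S = UNIV" "pos_def Q"
proof -
  have "K *v (matrix_inv K *v x) = x" for x
    using matrix_inv(1)[OF pos_def_invertible[OF assms]] by (simp add: matrix_vector_mul_assoc)
  then show "S = UNIV" by (metis UNIV_eq_I rangeI)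
  then show "pos_def Q" using Q_sym Q_pos by (auto simp: pos_def_def)
qed

lemma range_not_UNIV: "\<not> invertible K \<Longrightarrow> S \<noteq> UNIV"
  using matrix_right_invertible_surjective[of K] by (auto simp: invertible_right_inverse)

text \<open>The affine density lemma is used with centre offset 0 and with \<open>pinv K\<close> as
  its own compression. The identity block added on the complement disappears because almost every
  point of m + S differs from \<open>m\<close> by an element of \<open>S\<close>.\<close>

lemma prior_density:
  obtains C where "0 < C" "distr std_gaussian borel (\<lambda>z. m + A *v z) =
    density (lborel_affine m S) (\<lambda>z. ennreal (C * exp (- ((z - m) \<bullet> (pinv K *v (z - m))) / 2)))"
proof -
  obtain V where V: "P ** V = A" "transpose V ** (pinv K + (mat 1 - P)) ** V = mat 1"
    by (rule psd_factor_invertible[OF K P])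
  have XP: "pinv K = P ** pinv K ** P" by (simp add: X)
  have V': "transpose V ** (P ** pinv K ** P + (mat 1 - P)) ** V = mat 1"
    using V(2) XP by simp
  obtain C where C: "0 < C" "distr std_gaussian borel (\<lambda>z. m + 0 + (P ** V) *v z) =
    density (lborel_affine m S) (\<lambda>z. ennreal (C * exp (- ((z - m - 0) \<bullet> ((P ** pinv K ** P + (mat 1 - P)) *v (z - m - 0))) / 2)))"
    by (rule gaussian_affine_density[OF V' P subspace_0[OF PD(7)] compressed_form_split[OF P]])
  have "distr std_gaussian borel (\<lambda>z. m + A *v z) =
    density (lborel_affine m S) (\<lambda>z. ennreal (C * exp (- ((z - m) \<bullet> ((P ** pinv K ** P + (mat 1 - P)) *v (z - m))) / 2)))"
    using C(2) by (simp add: V)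
  also have "\<dots> = density (lborel_affine m S) (\<lambda>z. ennreal (C * exp (- ((z - m) \<bullet> (pinv K *v (z - m))) / 2)))"
  proof (rule density_cong)
    show "AE z in lborel_affine m S. ennreal (C * exp (- ((z - m) \<bullet> ((P ** pinv K ** P + (mat 1 - P)) *v (z - m))) / 2)) =
        ennreal (C * exp (- ((z - m) \<bullet> (pinv K *v (z - m))) / 2))"
      using AE_lborel_affine[OF PD(7), of m] by eventually_elim (simp add: compressed_form_inner[OF P])
  qed measurable
  finally show thesis using that C(1) by blast
qed

text \<open>No factor of the posterior covariance is given in advance, so \<open>V\<close> comes
  from W-orthonormalisation; the covariance is then (P V)(P V)^T.\<close>

lemma posterior_density:
  obtains C G where "0 < C" "gaussian_law (density (lborel_affine m S) (\<lambda>z. ennreal (C * exp (- J \<eta> (z - m))))) (m + sol \<eta>) G"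
proof -
  obtain V :: "real^'n^'n" where V: "transpose V ** W ** V = mat 1" by (rule pos_def_factor[OF W])
  obtain C where C: "0 < C" "distr std_gaussian borel (\<lambda>z. m + sol \<eta> + (P ** V) *v z) =
    density (lborel_affine m S) (\<lambda>z. ennreal (C * exp (- ((z - m - sol \<eta>) \<bullet> (W *v (z - m - sol \<eta>))) / 2)))"
    by (rule gaussian_affine_density[OF V P sol(1)])
      (simp only: W_def, rule compressed_form_split[OF P])
  \<comment> \<open>Completing the square leaves the minimal value of \<open>J\<close> as a factor,
    which moves into the constant.\<close>
  let ?C = "C * exp (J \<eta> (sol \<eta>))"
  have [measurable]: "(\<lambda>z. J \<eta> (z - m)) \<in> borel_measurable borel" unfolding J_def by measurable
  have "density (lborel_affine m S) (\<lambda>z. ennreal (C * exp (- ((z - m - sol \<eta>) \<bullet> (W *v (z - m - sol \<eta>))) / 2))) =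
    density (lborel_affine m S) (\<lambda>z. ennreal (?C * exp (- J \<eta> (z - m))))"
  proof (rule density_cong)
    have eq: "C * exp (- ((x - sol \<eta>) \<bullet> (W *v (x - sol \<eta>))) / 2) = ?C * exp (- J \<eta> x)" if "x \<in> S" for x
    proof -
      have "(x - sol \<eta>) \<bullet> (W *v (x - sol \<eta>)) = (x - sol \<eta>) \<bullet> (Q *v (x - sol \<eta>))"
        unfolding W_def by (intro compressed_form_inner[OF P] subspace_diff[OF PD(7)] that sol)
      then show ?thesis
        unfolding J_square[OF that] by (simp add: exp_add[symmetric] mult.assoc)
    qed
    show "AE z in lborel_affine m S. ennreal (C * exp (- ((z - m - sol \<eta>) \<bullet> (W *v (z - m - sol \<eta>))) / 2)) =
        ennreal (?C * exp (- J \<eta> (z - m)))"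
      using AE_lborel_affine[OF PD(7), of m] by eventually_elim (simp only: eq)
  qed measurable
  then have "gaussian_law (density (lborel_affine m S) (\<lambda>z. ennreal (?C * exp (- J \<eta> (z - m))))) (m + sol \<eta>)
      ((P ** V) ** transpose (P ** V))"
    using C(2) unfolding gaussian_law_def by metis
  then show thesis using that[of ?C] C(1) by simp
qed

end


text \<open>The density \<open>p\<close> is defined at every point and for every \<eta>, so that its
  negative logarithm can be stated pointwise; an arbitrary conditional law is compared with it
  almost surely, as conditional laws are determined only up to null sets of the law of
  \<open>y\<close>. Phrasing the minimiser through \<open>is_arg_min\<close> makes its existence and
  uniqueness conclusions.\<close>

theorem theorem1:
  fixes M :: "'a measure"
    and f :: "'a \<Rightarrow> real^'n" and \<epsilon> y :: "'a \<Rightarrow> real^'p"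
    and m :: "real^'n" and K :: "real^'n^'n" and H :: "real^'n^'p" and R :: "real^'p^'p"
  defines "d \<equiv> \<lambda>\<eta>. \<eta> - H *v m"
    and "Q \<equiv> pinv K + transpose H ** matrix_inv R ** H"
  defines "q \<equiv> \<lambda>\<eta>. - ((transpose H ** matrix_inv R) *v d \<eta>)"
    and "c \<equiv> \<lambda>\<eta>. 1/2 * (d \<eta> \<bullet> (matrix_inv R *v d \<eta>))"
  defines "J \<equiv> \<lambda>\<eta> x. 1/2 * (x \<bullet> (Q *v x)) + q \<eta> \<bullet> x + c \<eta>"
    and "rangeK \<equiv> range ((*v) K)"
  defines "minimizer \<equiv> \<lambda>\<eta>. is_arg_min (J \<eta>) (\<lambda>x. x \<in> rangeK)"
  assumes "prob_space M"
    and "pos_semidef K" and "pos_def R"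
    and "f \<in> borel_measurable M" and "gaussian_law (distr M borel f) m K"
    and "\<epsilon> \<in> borel_measurable M" and "gaussian_law (distr M borel \<epsilon>) 0 R"
    and "prob_space.indep_set M (sets (vimage_algebra (space M) f borel))
                               (sets (vimage_algebra (space M) \<epsilon> borel))"
    and "y = (\<lambda>\<omega>. H *v f \<omega> + \<epsilon> \<omega>)"
  shows
    "(\<exists>p :: real^'p \<Rightarrow> real^'n \<Rightarrow> real.
       (\<forall>\<eta>. p \<eta> \<in> borel_measurable borel) \<and>
       regular_cond_law M f y (\<lambda>\<eta>. density (lborel_affine m rangeK) (\<lambda>z. ennreal (p \<eta> z))) \<and>
       (\<forall>\<kappa>. regular_cond_law M f y \<kappa> \<longrightarrow>
          (AE \<eta> in distr M borel y.
             \<kappa> \<eta> = density (lborel_affine m rangeK) (\<lambda>z. ennreal (p \<eta> z)))) \<and>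
       (\<forall>\<eta>. \<exists>C :: real. \<forall>x.
          neg_log (p \<eta> (m + x)) = (if x \<in> rangeK then ereal (J \<eta> x + C) else \<infinity>)) \<and>
       (\<forall>\<eta> x. minimizer \<eta> x \<longrightarrow>
          integrable (density (lborel_affine m rangeK) (\<lambda>z. ennreal (p \<eta> z))) (\<lambda>z. z) \<and>
          (\<integral>z. z \<partial>density (lborel_affine m rangeK) (\<lambda>z. ennreal (p \<eta> z))) = m + x)) \<and>
     (\<forall>\<eta> x. J \<eta> x = 1/2 * ((d \<eta> - H *v x) \<bullet> (matrix_inv R *v (d \<eta> - H *v x)))
                    + 1/2 * (x \<bullet> (pinv K *v x))) \<and>
     (\<forall>\<eta>. convex_on UNIV (J \<eta>)) \<and>
     (pos_def K \<longrightarrow> rangeK = UNIV \<and> pos_def Q) \<and>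
     (\<not> invertible K \<longrightarrow> rangeK \<noteq> UNIV) \<and>
     (\<forall>\<eta>. \<exists>!x. minimizer \<eta> x) \<and>
     (\<forall>\<eta> x. minimizer \<eta> x \<longrightarrow> (\<forall>v\<in>rangeK. v \<bullet> (Q *v x) = v \<bullet> (- q \<eta>))) \<and>
     (pos_def K \<or> range ((*v) (transpose H)) \<subseteq> rangeK \<longrightarrow>
           (\<forall>\<eta> x. minimizer \<eta> x \<longrightarrow> Q *v x = - q \<eta>)) \<and>
     (integrable M f) \<and>
     (\<forall>i. AE \<omega> in M. \<forall>x. minimizer (y \<omega>) x \<longrightarrow>
           real_cond_exp M (vimage_algebra (space M) y borel) (\<lambda>\<omega>. f \<omega> $ i) \<omega> = (m + x) $ i) \<and>
     (\<forall>\<kappa>. regular_cond_law M f y \<kappa> \<longrightarrow>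
           (AE \<eta> in distr M borel y. \<forall>x. minimizer \<eta> x \<longrightarrow>
              (\<exists>P. gaussian_law (\<kappa> \<eta>) (m + x) P) \<and>
              integrable (\<kappa> \<eta>) (\<lambda>z. z) \<and> (\<integral>z. z \<partial>\<kappa> \<eta>) = m + x))"
proof -
  interpret prob_space M by fact
  note [measurable] = \<open>f \<in> borel_measurable M\<close> \<open>\<epsilon> \<in> borel_measurable M\<close>
  obtain A :: "real^'n^'n" where A: "A ** transpose A = K" "distr M borel f = distr std_gaussian borel (\<lambda>z. m + A *v z)"
    using \<open>gaussian_law (distr M borel f) m K\<close> by (auto simp: gaussian_law_def)
  obtain E :: "real^'p^'p" where E: "E ** transpose E = R" "distr M borel \<epsilon> = distr std_gaussian borel (\<lambda>z. 0 + E *v z)"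
    using \<open>gaussian_law (distr M borel \<epsilon>) 0 R\<close> unfolding gaussian_law_def by metis
  have "subspace (range ((*v) K))" by (auto intro!: linear_subspace_image)
  then obtain P where P: "orth_proj P (range ((*v) K))" by (rule orth_proj_exists)
  interpret E: map_estimation m K A P H R
    using A(1) P \<open>pos_def R\<close> by unfold_locales simp_all
  have d: "d = E.d" and Q: "Q = E.Q" and b: "q = (\<lambda>\<eta>. - E.b \<eta>)" and J: "J = E.J"
    by (simp_all add: fun_eq_iff d_def E.d_def Q_def E.Q_def q_def E.b_def J_def E.J_def c_def)
  have min: "minimizer \<eta> x \<longleftrightarrow> x = E.sol \<eta>" for \<eta> x
    unfolding minimizer_def J rangeK_def by (rule E.is_arg_min_J_iff)

  \<comment> \<open>From E E^T = R, the matrix E^T R^-1 is a right inverse of the square matrix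
    \<open>E\<close>, hence a left inverse: R^-1 is the form that turns the noise into a standard
    Gaussian.\<close>
  have "E ** (transpose E ** matrix_inv R) = mat 1"
    by (simp add: matrix_mul_assoc E matrix_inv[OF pos_def_invertible[OF E.R]])
  then have E_inv: "transpose E ** matrix_inv R ** E = mat 1" using matrix_left_right_inverse by blast
  obtain Ce where Ce: "0 < Ce" "distr M borel \<epsilon> = density lborel (\<lambda>e. ennreal (Ce * exp (- (e \<bullet> (matrix_inv R *v e)) / 2)))"
    by (rule gaussian_image_density[OF E_inv, of 0]) (simp add: E(2))
  obtain C0 where C0: "0 < C0" "distr M borel f =
      density (lborel_affine m rangeK) (\<lambda>z. ennreal (C0 * exp (- ((z - m) \<bullet> (pinv K *v (z - m))) / 2)))"
    by (rule E.prior_density) (simp add: A(2) rangeK_def)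
  define lik where "lik z \<eta> = Ce * exp (- ((\<eta> - H *v z) \<bullet> (matrix_inv R *v (\<eta> - H *v z))) / 2)" for z \<eta>
  have y_meas[measurable]: "y \<in> borel_measurable M" unfolding \<open>y = _\<close> by measurable
  have lik_meas[measurable]: "(\<lambda>(z, \<eta>). lik z \<eta>) \<in> borel_measurable (borel \<Otimes>\<^sub>M borel)"
    unfolding lik_def split_beta' by measurable
  interpret B: bayes_density M f y lik Ce
  proof unfold_locales
    show "0 < lik z \<eta>" for z \<eta> using Ce(1) by (simp add: lik_def)
    show "lik z \<eta> \<le> Ce" for z \<eta> using Ce(1) E.Ri_nonneg by (simp add: lik_def)
    show "distr M (borel \<Otimes>\<^sub>M borel) (\<lambda>\<omega>. (f \<omega>, y \<omega>)) =
        density (distr M borel f \<Otimes>\<^sub>M lborel) (\<lambda>(z, \<eta>). ennreal (lik z \<eta>))"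
      unfolding \<open>y = _\<close> lik_def
      by (rule joint_law_additive_noise[OF \<open>prob_space M\<close> _ _ _ _ \<open>indep_set _ _\<close> Ce(2)]) measurable
  qed measurable

  \<comment> \<open>The normalising constants of prior and noise, divided by the evidence.\<close>
  define D where "D \<eta> = C0 * Ce / B.evidence \<eta>" for \<eta>
  have D_pos: "0 < D \<eta>" for \<eta> using C0(1) Ce(1) B.evidence_pos by (simp add: D_def)
  \<comment> \<open>\<open>J\<close> is finite off the range too, so \<open>p\<close> has to be set
    to 0 there for \<open>neg_log\<close> to be infinite. This changes the density only on a null
    set of \<open>lborel_affine m rangeK\<close>.\<close>
  define p where "p \<eta> z = (if z - m \<in> rangeK then D \<eta> * exp (- J \<eta> (z - m)) else 0)" for \<eta> z
  have [measurable]: "rangeK \<in> sets borel"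
    unfolding rangeK_def by (rule borel_closed[OF closed_subspace[OF E.PD(7)]])
  have [measurable]: "(\<lambda>z. J \<eta> (z - m)) \<in> borel_measurable borel" for \<eta> unfolding J_def by measurable
  have p_meas[measurable]: "p \<eta> \<in> borel_measurable borel" for \<eta> unfolding p_def[abs_def] by measurable
  have AE_S: "AE z in lborel_affine m rangeK. z - m \<in> rangeK"
    unfolding rangeK_def by (rule AE_lborel_affine[OF E.PD(7)])
  have post: "B.posterior \<eta> = density (lborel_affine m rangeK) (\<lambda>z. ennreal (p \<eta> z))" for \<eta>
  proof -
    \<comment> \<open>Bayes' rule at the level of exponents: by \<open>J_misfit\<close>, the prior
      and likelihood exponents add up to - J.\<close>
    have "C0 * exp (- ((z - m) \<bullet> (pinv K *v (z - m))) / 2) * (lik z \<eta> / B.evidence \<eta>) = D \<eta> * exp (- J \<eta> (z - m))" for z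
    proof -
      have "\<eta> - H *v z = d \<eta> - H *v (z - m)" by (simp add: d_def matrix_vector_mult_diff_distrib)
      then have "- J \<eta> (z - m) = - ((z - m) \<bullet> (pinv K *v (z - m))) / 2 + - ((\<eta> - H *v z) \<bullet> (matrix_inv R *v (\<eta> - H *v z))) / 2"
        unfolding J E.J_misfit d by simp
      then show ?thesis by (simp only: exp_add D_def lik_def) simp
    qed
    then have "ennreal (C0 * exp (- ((z - m) \<bullet> (pinv K *v (z - m))) / 2)) * ennreal (lik z \<eta> / B.evidence \<eta>) =
        ennreal (D \<eta> * exp (- J \<eta> (z - m)))" for z
      using C0(1) by (simp add: ennreal_mult'[symmetric])
    then have "B.posterior \<eta> = density (lborel_affine m rangeK) (\<lambda>z. ennreal (D \<eta> * exp (- J \<eta> (z - m))))"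
      unfolding B.posterior_def C0(2) by (subst density_density_eq) simp_all
    also have "\<dots> = density (lborel_affine m rangeK) (\<lambda>z. ennreal (p \<eta> z))"
      using AE_S by (intro density_cong) (auto simp: p_def)
    finally show ?thesis .
  qed
  \<comment> \<open>The Gaussian law found earlier and the posterior have proportional densities on
    m + S. Both are probability measures, so the ratio \<open>?r\<close> is 1 and the unknown
    constants never need to be matched.\<close>
  have gauss: "\<exists>G. gaussian_law (B.posterior \<eta>) (m + E.sol \<eta>) G" for \<eta>
  proof -
    obtain C G where C: "0 < C" and
      G: "gaussian_law (density (lborel_affine m (range ((*v) K))) (\<lambda>z. ennreal (C * exp (- E.J \<eta> (z - m))))) (m + E.sol \<eta>) G"
      by (rule E.posterior_density)
    let ?r = "C / D \<eta>"
    let ?N = "density (lborel_affine m (range ((*v) K))) (\<lambda>z. ennreal (C * exp (- E.J \<eta> (z - m))))"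
    have "?N = density (lborel_affine m rangeK) (\<lambda>z. ennreal (p \<eta> z) * ennreal ?r)"
      unfolding rangeK_def[symmetric] J[symmetric]
      using AE_S C D_pos[of \<eta>]
      by (intro density_cong) (auto simp: p_def ennreal_mult'[symmetric])
    also have "\<dots> = density (B.posterior \<eta>) (\<lambda>_. ennreal ?r)"
      unfolding post by (subst density_density_eq) simp_all
    finally have N: "?N = density (B.posterior \<eta>) (\<lambda>_. ennreal ?r)" .
    interpret post: prob_space "B.posterior \<eta>" by (rule B.prob_space_posterior)
    have "emeasure ?N (space ?N) = 1" by (rule prob_space.emeasure_space_1[OF gaussian_law_mean(1)[OF G]])
    then have "ennreal ?r = 1"
      unfolding N space_density emeasure_density_const[OF sets.top] post.emeasure_space_1 by simp
    then have "?N = B.posterior \<eta>" unfolding N by (simp add: density_1)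
    then show ?thesis using G by auto
  qed
  have mean: "integrable (B.posterior \<eta>) (\<lambda>z. z)" "(\<integral>z. z \<partial>B.posterior \<eta>) = m + E.sol \<eta>" for \<eta>
    using gauss[of \<eta>] gaussian_law_mean by blast+
  have uniq: "AE \<eta> in distr M borel y. \<kappa> \<eta> = B.posterior \<eta>" if "regular_cond_law M f y \<kappa>" for \<kappa>
    by (rule regular_cond_law_unique[OF \<open>prob_space M\<close> y_meas that B.regular_cond_law_posterior])
  have int_f: "integrable M f"
    using gaussian_law_mean(2)[OF \<open>gaussian_law (distr M borel f) m K\<close>] by (simp add: integrable_distr_eq)
  have log: "\<exists>C. \<forall>x. neg_log (p \<eta> (m + x)) = (if x \<in> rangeK then ereal (J \<eta> x + C) else \<infinity>)" for \<eta>
    \<comment> \<open>The additive constant is - ln D, which depends on the observation but not on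
      x.\<close>
    using D_pos[of \<eta>] by (intro exI[of _ "- ln (D \<eta>)"]) (simp add: neg_log_def p_def ln_mult)
  \<comment> \<open>Conditional expectation is taken coordinate by coordinate; the coordinate map is
    bounded linear, so it commutes with the posterior mean.\<close>
  have cond: "AE \<omega> in M. \<forall>x. minimizer (y \<omega>) x \<longrightarrow>
      real_cond_exp M (vimage_algebra (space M) y borel) (\<lambda>\<omega>. f \<omega> $ i) \<omega> = (m + x) $ i" for i
  proof -
    have "(\<integral>z. z $ i \<partial>B.posterior \<eta>) = (m + E.sol \<eta>) $ i" for \<eta>
      using integral_bounded_linear[OF bounded_linear_vec_nth[of i] mean(1)[of \<eta>]] mean(2)[of \<eta>] by simp
    moreover have "integrable M (\<lambda>\<omega>. f \<omega> $ i)"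
      by (rule integrable_bounded_linear[OF bounded_linear_vec_nth int_f])
    ultimately show ?thesis
      using B.real_cond_exp_posterior[of "\<lambda>z. z $ i"] by (simp add: min)
  qed
  show ?thesis
  proof (intro conjI exI[of _ p])
    show "\<forall>\<eta>. p \<eta> \<in> borel_measurable borel" by simp
    show "regular_cond_law M f y (\<lambda>\<eta>. density (lborel_affine m rangeK) (\<lambda>z. ennreal (p \<eta> z)))"
      using B.regular_cond_law_posterior by (simp add: post[symmetric])
    show "\<forall>\<kappa>. regular_cond_law M f y \<kappa> \<longrightarrow> (AE \<eta> in distr M borel y.
        \<kappa> \<eta> = density (lborel_affine m rangeK) (\<lambda>z. ennreal (p \<eta> z)))"
      using uniq by (simp add: post[symmetric])
    show "\<forall>\<eta>. \<exists>C. \<forall>x. neg_log (p \<eta> (m + x)) = (if x \<in> rangeK then ereal (J \<eta> x + C) else \<infinity>)"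
      using log by blast
    show "\<forall>\<eta> x. minimizer \<eta> x \<longrightarrow>
        integrable (density (lborel_affine m rangeK) (\<lambda>z. ennreal (p \<eta> z))) (\<lambda>z. z) \<and>
        (\<integral>z. z \<partial>density (lborel_affine m rangeK) (\<lambda>z. ennreal (p \<eta> z))) = m + x"
      using mean by (simp add: min post[symmetric])
    show "\<forall>\<eta> x. J \<eta> x = 1/2 * ((d \<eta> - H *v x) \<bullet> (matrix_inv R *v (d \<eta> - H *v x))) + 1/2 * (x \<bullet> (pinv K *v x))"
      unfolding J d using E.J_misfit by blast
    show "\<forall>\<eta>. convex_on UNIV (J \<eta>)" unfolding J using E.convex_J by blast
    show "pos_def K \<longrightarrow> rangeK = UNIV \<and> pos_def Q" unfolding Q rangeK_def using E.pos_def_K by blast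
    show "\<not> invertible K \<longrightarrow> rangeK \<noteq> UNIV" unfolding rangeK_def using E.range_not_UNIV by blast
    show "\<forall>\<eta>. \<exists>!x. minimizer \<eta> x" by (simp add: min)
    show "\<forall>\<eta> x. minimizer \<eta> x \<longrightarrow> (\<forall>v\<in>rangeK. v \<bullet> (Q *v x) = v \<bullet> (- q \<eta>))"
      unfolding Q b rangeK_def using E.normal_equation_weak by (simp only: min minus_minus) blast
    show "pos_def K \<or> range ((*v) (transpose H)) \<subseteq> rangeK \<longrightarrow> (\<forall>\<eta> x. minimizer \<eta> x \<longrightarrow> Q *v x = - q \<eta>)"
      unfolding Q b rangeK_def using E.normal_equation E.pos_def_K by (simp only: min minus_minus) blast
    show "integrable M f" by (rule int_f)
    show "\<forall>i. AE \<omega> in M. \<forall>x. minimizer (y \<omega>) x \<longrightarrow>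
        real_cond_exp M (vimage_algebra (space M) y borel) (\<lambda>\<omega>. f \<omega> $ i) \<omega> = (m + x) $ i"
      using cond by blast
    show "\<forall>\<kappa>. regular_cond_law M f y \<kappa> \<longrightarrow> (AE \<eta> in distr M borel y. \<forall>x. minimizer \<eta> x \<longrightarrow>
        (\<exists>P. gaussian_law (\<kappa> \<eta>) (m + x) P) \<and> integrable (\<kappa> \<eta>) (\<lambda>z. z) \<and> (\<integral>z. z \<partial>\<kappa> \<eta>) = m + x)"
    proof (intro allI impI)
      fix \<kappa> assume "regular_cond_law M f y \<kappa>"
      from uniq[OF this] show "AE \<eta> in distr M borel y. \<forall>x. minimizer \<eta> x \<longrightarrow>
        (\<exists>P. gaussian_law (\<kappa> \<eta>) (m + x) P) \<and> integrable (\<kappa> \<eta>) (\<lambda>z. z) \<and> (\<integral>z. z \<partial>\<kappa> \<eta>) = m + x"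
        by eventually_elim (use gauss mean in \<open>simp add: min\<close>)
    qed
  qed
qed

end
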